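(* Let $j$ be an almost complex structure on a smooth manifold $M$. For every $p\ge 0$, the generalized Dolbeault cohomology and the $j$-transverse Dolbeault cohomology coincide in degree $(p,0)$: $$H_{Dol}^{(p,0)}(M)= H_{j\,trans}^{p,0}(M)$$ (equality as subspaces of the space $\Omega_j^{p,0}$ of $(p,0)$-forms on $M$).
   Context: An almost complex structure $j$ on $M$ is a smooth section of $\mathrm{End}(TM)$ with $j^2=-\mathrm{Id}$. $\mathfrak{X}(M)$ is the Lie algebra of smooth real vector fields. $TM^{\mathbb C}=T_j^{1,0}\oplus T_j^{0,1}$ is the splitting into $\pm i$ eigenbundles of $j$, and $\Omega^k(M,\mathbb C)=\oplus_{p+q=k}\Omega_j^{p,q}$ the induced splitting of complex forms ($\Omega_j^{p,q}=0$ if $p<0$ or $q<0$). The exterior differential satisfies $d\Omega_j^{p,q}\subset \Omega_j^{p-1,q+2}\oplus\Omega_j^{p,q+1}\oplus\Omega_j^{p+1,q}\oplus\Omega_j^{p+2,q-1}$ and splits accordingly as $d=\bar\mu\oplus\bar\partial\oplus\partial\oplus\mu$. Generalized Dolbeault cohomology (Cirici-Wilson): $d^2=0$ gives $\bar\mu^2=0$, $\bar\mu\bar\partial+\bar\partial\bar\mu=0$ and $\bar\mu\partial+\partial\bar\mu+\bar\partial^2=0$. Set $H_{\bar\mu}^{(p,q)}=\mathrm{Ker}\,\bar\mu|_{\Omega_j^{p,q}}/\mathrm{Im}\,\bar\mu|_{\Omega_j^{p+1,q-2}}$. Then $\bar\partial$ induces a map $\widetilde{\bar\partial}:H_{\bar\mu}^{(p,q)}\to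 H_{\bar\mu}^{(p,q+1)}$, $\omega+\mathrm{Im}\,\bar\mu\mapsto\bar\partial\omega+\mathrm{Im}\,\bar\mu$, with $\widetilde{\bar\partial}^2=0$, and $H_{Dol}^{(p,q)}(M)=\mathrm{Ker}\,\widetilde{\bar\partial}|_{H_{\bar\mu}^{(p,q)}}/\mathrm{Im}\,\widetilde{\bar\partial}|_{H_{\bar\mu}^{(p,q-1)}}$. Limit distribution: the Nijenhuis tensor is $N^j(X,Y)=[jX,jY]-j[jX,Y]-j[X,jY]-[X,Y]$. Let $\mathcal{D}_j^{(1)}=\mathcal{I}m\,N^j$ be the $C^\infty(M,\mathbb R)$-submodule of $\mathfrak{X}(M)$ spanned by all $N^j(X,Y)$, $X,Y\in\mathfrak{X}(M)$, and inductively $$\mathcal{D}_j^{(k+1)}=\mathcal{D}_j^{(k)}+\sum_{U\in\mathcal{D}_j^{(k)}}\mathcal{I}m\,\mathcal{L}_Uj+[\mathcal{D}_j^{(k)},\mathcal{D}_j^{(k)}],$$ where $(\mathcal{L}_Uj)X=[U,jX]-j[U,X]$, $\mathcal{I}m\,\mathcal{L}_Uj=\{(\mathcal{L}_Uj)X: X\in\mathfrak{X}(M)\}$, and $[\cdot,\cdot]$ of two spaces means the linear span of brackets. Put $\mathcal{D}_j^\infty=\bigcup_{k\ge1}\mathcal{D}_j^{(k)}$. $j$-transverse Dolbeault cohomology: let $\Omega^{p,q}_{\mathcal{D}_j^\infty,[j]}=\{\omega\in\Omega_j^{p,q}: \iota(X)\omega=0,\ \mathcal{L}_X\omega=0\ \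 \forall X\in\mathcal{D}_j^\infty\}$. One has $d\,\Omega^{p,q}_{\mathcal{D}_j^\infty,[j]}\subset\Omega^{p+1,q}_{\mathcal{D}_j^\infty,[j]}\oplus\Omega^{p,q+1}_{\mathcal{D}_j^\infty,[j]}$; let $\bar\partial_{\mathcal{D}_j^\infty,[j]}$ be the component with values in $\Omega^{p,q+1}_{\mathcal{D}_j^\infty,[j]}$ (it is the restriction of $\bar\partial$, and squares to zero). Then $$H_{j\,trans}^{p,q}(M)=\mathrm{Ker}\,\bar\partial_{\mathcal{D}_j^\infty,[j]}|_{\Omega^{p,q}_{\mathcal{D}_j^\infty,[j]}}\big/\mathrm{Im}\,\bar\partial_{\mathcal{D}_j^\infty,[j]}|_{\Omega^{p,q-1}_{\mathcal{D}_j^\infty,[j]}}.$$ For $q=0$ both cohomologies are quotients by the zero space, hence subspaces of $\Omega_j^{p,0}$. *)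

theory Defs
  imports "HOL-Analysis.Analysis" "HOL-Library.Function_Algebras" "HOL-Library.Set_Algebras"
begin

section \<open>Smooth manifolds\<close>

text \<open>For open \<open>S\<close> in a finite-dimensional space this is the usual class \<open>C\<^sup>k\<close>: all iterated
  directional derivatives of order at most \<open>k\<close> exist and are continuous.\<close>

primrec Ck_on :: "nat \<Rightarrow> 'e::real_normed_vector set \<Rightarrow> ('e \<Rightarrow> 'b::real_normed_vector) \<Rightarrow> bool" where
  "Ck_on 0 S f \<longleftrightarrow> continuous_on S f"
| "Ck_on (Suc k) S f \<longleftrightarrow>
     (\<forall>x\<in>S. f differentiable (at x)) \<and> (\<forall>v. Ck_on k S (\<lambda>x. frechet_derivative f (at x) v))"

definition smooth_on :: "'e::real_normed_vector set \<Rightarrow> ('e \<Rightarrow> 'b::real_normed_vector) \<Rightarrow> bool" where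
  "smooth_on S f \<longleftrightarrow> (\<forall>k. Ck_on k S f)"

type_synonym 'a tangent = "('a \<Rightarrow> real) \<Rightarrow> real"
type_synonym 'a vfield = "'a \<Rightarrow> 'a tangent"
type_synonym 'a form = "'a vfield list \<Rightarrow> 'a \<Rightarrow> complex"

text \<open>The manifold is the whole type \<open>'a\<close> with its (Hausdorff, second countable) topology. The
  model space \<open>'e\<close> is a finite-dimensional real normed space rather than a
  \<^class>\<open>euclidean_space\<close>, so that dimension 0 is not excluded.\<close>

locale smooth_manifold =
  fixes atlas :: "('a::{t2_space,second_countable_topology} set \<times> ('a \<Rightarrow> 'e::real_normed_vector)) set"
  assumes finite_dim: "\<exists>B::'e set. finite B \<and> span B = UNIV"
    and atlas_cover: "(\<Union>(U, \<phi>)\<in>atlas. U) = UNIV"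
    and atlas_chart: "\<And>U \<phi>. (U, \<phi>) \<in> atlas \<Longrightarrow>
          open U \<and> open (\<phi> ` U) \<and> homeomorphism U (\<phi> ` U) \<phi> (inv_into U \<phi>)"
    and atlas_compatible: "\<And>U \<phi> V \<psi>. (U, \<phi>) \<in> atlas \<Longrightarrow> (V, \<psi>) \<in> atlas \<Longrightarrow>
          smooth_on (\<phi> ` (U \<inter> V)) (\<psi> \<circ> inv_into U \<phi>)"
begin

definition smooth_fun :: "('a \<Rightarrow> 'b::real_normed_vector) set" where
  "smooth_fun = {f. \<forall>(U, \<phi>)\<in>atlas. smooth_on (\<phi> ` U) (f \<circ> inv_into U \<phi>)}"

text \<open>Tangent vectors at \<open>x\<close> are the derivations at \<open>x\<close> of the algebra of smooth functions,
  extended by 0 to non-smooth functions so that equality of tangent vectors is equality of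
  functionals.\<close>

definition tangent_space :: "'a \<Rightarrow> 'a tangent set" where
  "tangent_space x = {v.
     (\<forall>f\<in>smooth_fun. \<forall>g\<in>smooth_fun. v (f + g) = v f + v g) \<and>
     (\<forall>c. \<forall>f\<in>smooth_fun. v (\<lambda>y. c * f y) = c * v f) \<and>
     (\<forall>f\<in>smooth_fun. \<forall>g\<in>smooth_fun. v (\<lambda>y. f y * g y) = f x * v g + g x * v f) \<and>
     (\<forall>f. f \<notin> smooth_fun \<longrightarrow> v f = 0)}"

definition vector_fields :: "'a vfield set" where
  "vector_fields = {X. (\<forall>x. X x \<in> tangent_space x) \<and> (\<forall>f\<in>smooth_fun. (\<lambda>x. X x f) \<in> smooth_fun)}"

end

definition fmult :: "('a \<Rightarrow> real) \<Rightarrow> 'a vfield \<Rightarrow> 'a vfield" where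
  "fmult f X = (\<lambda>x g. f x * X x g)"

definition bracket :: "'a vfield \<Rightarrow> 'a vfield \<Rightarrow> 'a vfield" where
  "bracket X Y = (\<lambda>x f. X x (\<lambda>y. Y y f) - Y x (\<lambda>y. X y f))"

text \<open>The submodule generated by \<open>S\<close> over the ring \<open>R\<close> of functions.\<close>

inductive_set fspan :: "('a \<Rightarrow> real) set \<Rightarrow> 'a vfield set \<Rightarrow> 'a vfield set"
  for R :: "('a \<Rightarrow> real) set" and S :: "'a vfield set" where
  fspan_zero: "0 \<in> fspan R S"
| fspan_step: "f \<in> R \<Longrightarrow> X \<in> S \<Longrightarrow> Y \<in> fspan R S \<Longrightarrow> fmult f X + Y \<in> fspan R S"

definition lspan :: "'a vfield set \<Rightarrow> 'a vfield set" where
  "lspan S = fspan (range (\<lambda>c x. c)) S"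


section \<open>Complex differential forms\<close>

text \<open>The action of a real vector field on a complex valued function.\<close>

definition vact :: "'a vfield \<Rightarrow> ('a \<Rightarrow> complex) \<Rightarrow> 'a \<Rightarrow> complex" where
  "vact X h = (\<lambda>x. Complex (X x (\<lambda>y. Re (h y))) (X x (\<lambda>y. Im (h y))))"

text \<open>Interior product.\<close>

definition contract :: "'a vfield \<Rightarrow> 'a form \<Rightarrow> 'a form" where
  "contract X \<omega> = (\<lambda>Xs. \<omega> (X # Xs))"

context smooth_manifold
begin

text \<open>A complex \<open>k\<close>-form is regarded as a tensor field in the module sense: an alternating map on
  \<open>k\<close>-tuples of vector fields, multilinear over the smooth real functions, with smooth complex
  values. It is extended by 0 to all other lists; thus the zero map is a form of every degree and
  forms of different degree can be added.\<close>

definition forms :: "nat \<Rightarrow> 'a form set" where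
  "forms k = {\<omega>.
     (\<forall>Xs. set Xs \<subseteq> vector_fields \<and> length Xs = k \<longrightarrow> \<omega> Xs \<in> smooth_fun) \<and>
     (\<forall>Xs. \<not> (set Xs \<subseteq> vector_fields \<and> length Xs = k) \<longrightarrow> \<omega> Xs = 0) \<and>
     (\<forall>Xs Ys. \<forall>f\<in>smooth_fun. \<forall>X\<in>vector_fields. \<forall>Y\<in>vector_fields.
        set Xs \<subseteq> vector_fields \<and> set Ys \<subseteq> vector_fields \<and> length Xs + length Ys + 1 = k \<longrightarrow>
        \<omega> (Xs @ (fmult f X + Y) # Ys) =
          (\<lambda>x. complex_of_real (f x) * \<omega> (Xs @ X # Ys) x + \<omega> (Xs @ Y # Ys) x)) \<and>
     (\<forall>Xs i j. set Xs \<subseteq> vector_fields \<and> length Xs = k \<and> i < j \<and> j < k \<and> Xs ! i = Xs ! j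
        \<longrightarrow> \<omega> Xs = 0)}"

text \<open>The exterior differential, by the invariant (Koszul) formula; \<open>nths Xs (- {i})\<close> is \<open>Xs\<close> with
  the entry at position \<open>i\<close> omitted.\<close>

definition ext_d :: "'a form \<Rightarrow> 'a form" where
  "ext_d \<omega> = (\<lambda>Xs x. if set Xs \<subseteq> vector_fields then
       (\<Sum>i<length Xs. (-1) ^ i * vact (Xs ! i) (\<omega> (nths Xs (- {i}))) x)
     + (\<Sum>j<length Xs. \<Sum>i<j. (-1) ^ (i + j) *
          \<omega> (bracket (Xs ! i) (Xs ! j) # nths Xs (- {i, j})) x)
     else 0)"

definition lie_form :: "'a vfield \<Rightarrow> 'a form \<Rightarrow> 'a form" where
  "lie_form X \<omega> = (\<lambda>Xs x. if set Xs \<subseteq> vector_fields then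
       vact X (\<omega> Xs) x - (\<Sum>i<length Xs. \<omega> (Xs[i := bracket X (Xs ! i)]) x)
     else 0)"

end

text \<open>A complex vector field \<open>X + \<i>Y\<close> is represented by the pair \<open>(X, Y)\<close>. The following is the
  complex multilinear extension of a form to complex vector fields.\<close>

primrec complexify :: "('a vfield \<times> 'a vfield) list \<Rightarrow> 'a form \<Rightarrow> 'a \<Rightarrow> complex" where
  "complexify [] \<omega> = \<omega> []"
| "complexify (Z # Zs) \<omega> =
     (\<lambda>x. complexify Zs (contract (fst Z) \<omega>) x + \<i> * complexify Zs (contract (snd Z) \<omega>) x)"


section \<open>Almost complex manifolds\<close>

definition japply :: "('a \<Rightarrow> 'a tangent \<Rightarrow> 'a tangent) \<Rightarrow> 'a vfield \<Rightarrow> 'a vfield" where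
  "japply J X = (\<lambda>x. J x (X x))"

text \<open>\<open>J\<close> is a section of the endomorphism bundle of the tangent bundle; as usual, it is smooth iff
  it maps smooth vector fields to smooth vector fields. Values of \<open>J x\<close> outside the tangent space
  at \<open>x\<close> are irrelevant.\<close>

locale almost_complex_manifold = smooth_manifold atlas
  for atlas :: "('a::{t2_space,second_countable_topology} set \<times> ('a \<Rightarrow> 'e::real_normed_vector)) set" +
  fixes J :: "'a \<Rightarrow> 'a tangent \<Rightarrow> 'a tangent"
  assumes J_tangent: "\<And>x v. v \<in> tangent_space x \<Longrightarrow> J x v \<in> tangent_space x"
    and J_add: "\<And>x v w. v \<in> tangent_space x \<Longrightarrow> w \<in> tangent_space x \<Longrightarrow> J x (v + w) = J x v + J x w"
    and J_scale: "\<And>x c v. v \<in> tangent_space x \<Longrightarrow> J x (\<lambda>f. c * v f) = (\<lambda>f. c * J x v f)"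
    and J_square: "\<And>x v. v \<in> tangent_space x \<Longrightarrow> J x (J x v) = - v"
    and J_smooth: "\<And>X. X \<in> vector_fields \<Longrightarrow> japply J X \<in> vector_fields"
begin

abbreviation jv :: "'a vfield \<Rightarrow> 'a vfield" where
  "jv X \<equiv> japply J X"

text \<open>Sections of the eigenbundles for \<open>\<i>\<close> and \<open>-\<i>\<close>; note \<open>\<i> (X + \<i>Y) = - Y + \<i>X\<close>.\<close>

definition T10 :: "('a vfield \<times> 'a vfield) set" where
  "T10 = {(X, Y). X \<in> vector_fields \<and> Y \<in> vector_fields \<and> (jv X, jv Y) = (- Y, X)}"

definition T01 :: "('a vfield \<times> 'a vfield) set" where
  "T01 = {(X, Y). X \<in> vector_fields \<and> Y \<in> vector_fields \<and> (jv X, jv Y) = (Y, - X)}"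

text \<open>The summand of type \<open>(p,q)\<close> in the splitting induced on forms: those forms of degree \<open>p + q\<close>
  which vanish on \<open>r\<close> arguments of type \<open>(1,0)\<close> and \<open>s\<close> arguments of type \<open>(0,1)\<close> unless
  \<open>(r, s) = (p, q)\<close>.\<close>

definition Omega :: "int \<Rightarrow> int \<Rightarrow> 'a form set" where
  "Omega p q = (if p < 0 \<or> q < 0 then {0} else
     {\<omega>\<in>forms (nat (p + q)). \<forall>Zs Ws. set Zs \<subseteq> T10 \<and> set Ws \<subseteq> T01 \<and>
        int (length Zs + length Ws) = p + q \<and> int (length Zs) \<noteq> p \<longrightarrow> complexify (Zs @ Ws) \<omega> = 0})"

text \<open>The splitting of \<open>ext_d \<omega>\<close> for \<open>\<omega>\<close> of type \<open>(p,q)\<close>, and its first two components.\<close>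

definition d_splits :: "int \<Rightarrow> int \<Rightarrow> 'a form \<Rightarrow> 'a form \<Rightarrow> 'a form \<Rightarrow> 'a form \<Rightarrow> 'a form \<Rightarrow> bool" where
  "d_splits p q \<omega> a b c e \<longleftrightarrow>
     a \<in> Omega (p - 1) (q + 2) \<and> b \<in> Omega p (q + 1) \<and> c \<in> Omega (p + 1) q \<and>
     e \<in> Omega (p + 2) (q - 1) \<and> ext_d \<omega> = a + b + c + e"

definition mubar :: "int \<Rightarrow> int \<Rightarrow> 'a form \<Rightarrow> 'a form" where
  "mubar p q \<omega> = (THE a. \<exists>b c e. d_splits p q \<omega> a b c e)"

definition delbar :: "int \<Rightarrow> int \<Rightarrow> 'a form \<Rightarrow> 'a form" where
  "delbar p q \<omega> = (THE b. \<exists>a c e. d_splits p q \<omega> a b c e)"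


subsection \<open>Generalized Dolbeault cohomology\<close>

text \<open>The quotient of a space \<open>V\<close> by a subspace \<open>W\<close> is the set of cosets \<open>\<omega> +o W\<close> with \<open>\<omega> \<in> V\<close>;
  cosets are added by elementwise addition of sets (\<^theory>\<open>HOL-Library.Set_Algebras\<close>). The zero
  element of the quotient is \<open>W\<close> itself.\<close>

definition im_mubar :: "int \<Rightarrow> int \<Rightarrow> 'a form set" where
  "im_mubar p q = mubar (p + 1) (q - 2) ` Omega (p + 1) (q - 2)"

definition H_mubar :: "int \<Rightarrow> int \<Rightarrow> 'a form set set" where
  "H_mubar p q = (\<lambda>\<omega>. \<omega> +o im_mubar p q) ` {\<omega>\<in>Omega p q. mubar p q \<omega> = 0}"

text \<open>The union is over representatives of the class \<open>C\<close>; all of them give the same coset.\<close>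

definition delbar_tilde :: "int \<Rightarrow> int \<Rightarrow> 'a form set \<Rightarrow> 'a form set" where
  "delbar_tilde p q C = (\<Union>\<omega>\<in>C. delbar p q \<omega> +o im_mubar p (q + 1))"

definition H_Dol :: "int \<Rightarrow> int \<Rightarrow> 'a form set set set" where
  "H_Dol p q = (\<lambda>C. C +o (delbar_tilde p (q - 1) ` H_mubar p (q - 1))) `
     {C\<in>H_mubar p q. delbar_tilde p q C = im_mubar p (q + 1)}"


subsection \<open>The limit distribution\<close>

definition nijenhuis :: "'a vfield \<Rightarrow> 'a vfield \<Rightarrow> 'a vfield" where
  "nijenhuis X Y = bracket (jv X) (jv Y) - jv (bracket (jv X) Y) - jv (bracket X (jv Y)) - bracket X Y"

definition lie_j :: "'a vfield \<Rightarrow> 'a vfield \<Rightarrow> 'a vfield" where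
  "lie_j U X = bracket U (jv X) - jv (bracket U X)"

text \<open>Indexing is shifted by one: \<open>D_dist k\<close> is the \<open>(k+1)\<close>-st distribution of the sequence. The
  addition is that of subspaces.\<close>

primrec D_dist :: "nat \<Rightarrow> 'a vfield set" where
  "D_dist 0 = fspan smooth_fun {nijenhuis X Y | X Y. X \<in> vector_fields \<and> Y \<in> vector_fields}"
| "D_dist (Suc k) = D_dist k + lspan (\<Union>U\<in>D_dist k. lie_j U ` vector_fields)
     + lspan {bracket U V | U V. U \<in> D_dist k \<and> V \<in> D_dist k}"

definition D_inf :: "'a vfield set" where
  "D_inf = (\<Union>k. D_dist k)"


subsection \<open>Transverse Dolbeault cohomology\<close>

definition Omega_trans :: "int \<Rightarrow> int \<Rightarrow> 'a form set" where
  "Omega_trans p q = {\<omega>\<in>Omega p q. \<forall>X\<in>D_inf. contract X \<omega> = 0 \<and> lie_form X \<omega> = 0}"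

definition delbar_trans :: "int \<Rightarrow> int \<Rightarrow> 'a form \<Rightarrow> 'a form" where
  "delbar_trans p q \<omega> =
     (THE b. b \<in> Omega_trans p (q + 1) \<and> (\<exists>c\<in>Omega_trans (p + 1) q. ext_d \<omega> = b + c))"

definition H_trans :: "int \<Rightarrow> int \<Rightarrow> 'a form set set" where
  "H_trans p q = (\<lambda>\<omega>. \<omega> +o (delbar_trans p (q - 1) ` Omega_trans p (q - 1))) `
     {\<omega>\<in>Omega_trans p q. delbar_trans p q \<omega> = 0}"

text \<open>Spaces of classes modulo the zero space are regarded as spaces of forms by identifying the
  class \<open>{\<omega>}\<close> with \<open>\<omega>\<close>; for \<^const>\<open>H_Dol\<close>, an iterated quotient, this is done twice.\<close>

definition H_Dol_forms :: "int \<Rightarrow> 'a form set" where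
  "H_Dol_forms p = {\<omega>\<in>Omega p 0. {{\<omega>}} \<in> H_Dol p 0}"

definition H_trans_forms :: "int \<Rightarrow> 'a form set" where
  "H_trans_forms p = {\<omega>\<in>Omega p 0. {\<omega>} \<in> H_trans p 0}"

end

end

theory Submission
  imports Defs
begin

text \<open>In degree \<open>(p,0)\<close> all the subspaces that are divided out are images of zero spaces, so both cohomologies
consist of the \<open>(p,0)\<close>-forms that satisfy certain equations. The proof identifies both sets of
equations with a single condition: \<open>d\<omega>\<close> is of type \<open>(p+1,0)\<close>.

For the generalized Dolbeault cohomology this is the splitting of \<open>d\<omega>\<close> into its components of types
\<open>(p-1,2)\<close>, \<open>(p,1)\<close> and \<open>(p+1,0)\<close> (lemma \<open>mubar_delbar_eq_0_iff\<close>). For the transverse one, the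
point is that \<open>\<omega>\<close> and \<open>d\<omega>\<close> of types \<open>(p,0)\<close> and \<open>(p+1,0)\<close> force \<open>\<iota>\<^sub>U \<omega> = 0\<close> and \<open>L\<^sub>U \<omega> = 0\<close> for
every \<open>U\<close> in the limit distribution. Three observations prove it (lemma \<open>contract_D_dist_eq_0\<close>).

\<^item> For complex fields of type \<open>(0,1)\<close> with real parts \<open>X\<close> and \<open>Y\<close>, contracting \<open>d\<omega>\<close> with both of them
  gives \<open>\<iota>\<^sub>N \<omega>\<close> where \<open>N\<close> is the value of the Nijenhuis tensor on \<open>X\<close> and \<open>Y\<close>; so \<open>\<iota>\<^sub>N \<omega> = 0\<close> as soon as
  \<open>d\<omega>\<close> is of type \<open>(p+1,0)\<close>.
\<^item> Since \<open>d\<^sup>2 = 0\<close>, the hypothesis on \<open>\<omega>\<close> passes to \<open>d\<omega>\<close>. Hence whenever all forms with this property are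
  annihilated by \<open>\<iota>\<^sub>U\<close>, Cartan's formula yields \<open>L\<^sub>U \<omega> = \<iota>\<^sub>U d\<omega> + d\<iota>\<^sub>U \<omega> = 0\<close> as well.
\<^item> If \<open>\<iota>\<^sub>U \<omega> = 0\<close> and \<open>L\<^sub>U \<omega> = 0\<close> for all \<open>U\<close> in some step of the sequence of distributions, then
  \<open>\<iota>\<^sub>V \<omega> = 0\<close> for \<open>V = [U,U']\<close> because \<open>\<iota>\<^bsub>[U,U']\<^esub> = [L\<^sub>U, \<iota>\<^bsub>U'\<^esub>]\<close>, and for \<open>V = (L\<^sub>U j) X\<close> because contraction of \<open>\<omega>\<close>
  is complex linear, \<open>\<iota>\<^bsub>jX\<^esub> \<omega> = i \<iota>\<^sub>X \<omega>\<close>.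

Conversely, a transverse \<open>\<omega>\<close> has \<open>\<iota>\<^sub>N \<omega> = 0\<close>, so \<open>d\<omega>\<close> has only components \<open>b\<close> of type \<open>(p,1)\<close> and \<open>c\<close> of
type \<open>(p+1,0)\<close>. Both are transverse, because the limit distribution is \<open>j\<close>-invariant and contains the
values of \<open>L\<^sub>U j\<close>; so \<open>b\<close> is the transverse \<open>\<partial>\<close>-bar derivative of \<open>\<omega>\<close> (lemma \<open>ext_d_splits_transversally\<close>).

Two devices keep everything global and algebraic, without local frames. Forms are functions of
lists of vector fields, and an identity between operators on forms is proved by contracting both
sides with the head of the list; the Koszul formula is used only to derive Cartan's formula. The
splitting into types is the eigenspace decomposition of the operator \<open>weight\<close>, which acts
on \<open>(p,q)\<close>-forms as multiplication by \<open>p - q\<close>; components are obtained as polynomials in \<open>weight\<close>.\<close>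

section \<open>Smooth functions\<close>

text \<open>The class refers to derivatives at points of \<open>S\<close>, which for open \<open>S\<close> depend only on the values on \<open>S\<close>. This
is what allows derivatives to be computed by formulas that are valid on \<open>S\<close> only.\<close>

lemma Ck_on_cong:
  assumes "open S" "\<And>x. x \<in> S \<Longrightarrow> f x = g x" "Ck_on k S f"
  shows "Ck_on k S g"
  using assms(2,3)
proof (induction k arbitrary: f g)
  case 0
  then show ?case by (metis Ck_on.simps(1) continuous_on_cong)
next
  case (Suc k)
  have D: "g differentiable (at x)" "frechet_derivative g (at x) = frechet_derivative f (at x)" if "x \<in> S" for x
  proof -
    have "(f has_derivative frechet_derivative f (at x)) (at x)"
      using Suc.prems that frechet_derivative_works by auto
    hence g: "(g has_derivative frechet_derivative f (at x)) (at x)"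
      using assms(1) that Suc.prems(1) by (rule has_derivative_transform_within_open)
    show "g differentiable (at x)" using g differentiable_def by blast
    show "frechet_derivative g (at x) = frechet_derivative f (at x)"
      using frechet_derivative_at[OF g] by simp
  qed
  have "Ck_on k S (\<lambda>x. frechet_derivative g (at x) v)" for v
    using Suc.IH[of "\<lambda>x. frechet_derivative f (at x) v" "\<lambda>x. frechet_derivative g (at x) v"] Suc.prems D
    by simp
  then show ?case using D by simp
qed

lemma Ck_on_SucI:
  assumes "open S" "\<And>x. x \<in> S \<Longrightarrow> (f has_derivative f' x) (at x)" "\<And>v. Ck_on k S (\<lambda>x. f' x v)"
  shows "Ck_on (Suc k) S f"
proof -
  have "Ck_on k S (\<lambda>x. frechet_derivative f (at x) v)" for v
    by (rule Ck_on_cong[OF assms(1) _ assms(3)[of v]]) (simp add: frechet_derivative_at[OF assms(2), symmetric])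
  then show ?thesis using assms(2) by (auto simp: differentiable_def)
qed

lemma Ck_on_has_derivative:
  assumes "Ck_on (Suc k) S f" "x \<in> S"
  shows "(f has_derivative frechet_derivative f (at x)) (at x)"
  using assms by (simp add: frechet_derivative_works)

lemma Ck_on_Suc_imp: "Ck_on (Suc k) S f \<Longrightarrow> Ck_on k S f"
proof (induction k arbitrary: f)
  case 0
  then show ?case
    by (auto intro!: continuous_at_imp_continuous_on differentiable_imp_continuous_within)
next
  case (Suc k)
  have "Ck_on k S (\<lambda>x. frechet_derivative f (at x) v)" for v
    using Suc.prems by (intro Suc.IH) (simp only: Ck_on.simps(2)[of "Suc k"])
  then show ?case using Suc.prems by simp
qed

lemma Ck_on_const: "open S \<Longrightarrow> Ck_on k S (\<lambda>x. c)"
  by (induction k arbitrary: c) (simp_all add: frechet_derivative_const)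

lemma Ck_on_add:
  "open S \<Longrightarrow> Ck_on k S f \<Longrightarrow> Ck_on k S g \<Longrightarrow> Ck_on k S (\<lambda>x. f x + g x)"
proof (induction k arbitrary: f g)
  case 0
  then show ?case by (simp add: continuous_on_add)
next
  case (Suc k)
  show ?case
  proof (rule Ck_on_SucI[OF Suc.prems(1)])
    show "((\<lambda>x. f x + g x) has_derivative
            (\<lambda>v. frechet_derivative f (at x) v + frechet_derivative g (at x) v)) (at x)" if "x \<in> S" for x
      using Suc.prems that by (intro has_derivative_add Ck_on_has_derivative) auto
    show "Ck_on k S (\<lambda>x. frechet_derivative f (at x) v + frechet_derivative g (at x) v)" for v
      using Suc by simp
  qed
qed

lemma Ck_on_bounded_bilinear:
  assumes "bounded_bilinear B" "open S"
  shows "Ck_on k S f \<Longrightarrow> Ck_on k S g \<Longrightarrow> Ck_on k S (\<lambda>x. B (f x) (g x))"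
proof (induction k arbitrary: f g)
  case 0
  then show ?case using bounded_bilinear.continuous_on[OF assms(1)] by simp
next
  case (Suc k)
  show ?case
  proof (rule Ck_on_SucI[OF assms(2)])
    show "((\<lambda>x. B (f x) (g x)) has_derivative
            (\<lambda>v. B (f x) (frechet_derivative g (at x) v) + B (frechet_derivative f (at x) v) (g x))) (at x)"
      if "x \<in> S" for x
      using Suc.prems that
      by (intro bounded_bilinear.FDERIV[OF assms(1)] Ck_on_has_derivative) auto
    show "Ck_on k S (\<lambda>x. B (f x) (frechet_derivative g (at x) v) + B (frechet_derivative f (at x) v) (g x))"
      for v
      using Suc Ck_on_Suc_imp[OF Suc.prems(1)] Ck_on_Suc_imp[OF Suc.prems(2)]
      by (intro Ck_on_add assms(2)) auto
  qed
qed

lemma Ck_on_bounded_linear: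
  assumes "bounded_linear L" "open S"
  shows "Ck_on k S f \<Longrightarrow> Ck_on k S (\<lambda>x. L (f x))"
proof (induction k arbitrary: f)
  case 0
  then show ?case using bounded_linear.continuous_on[OF assms(1)] by simp
next
  case (Suc k)
  show ?case
  proof (rule Ck_on_SucI[OF assms(2)])
    show "((\<lambda>x. L (f x)) has_derivative (\<lambda>v. L (frechet_derivative f (at x) v))) (at x)"
      if "x \<in> S" for x
      using bounded_linear.has_derivative[OF assms(1)] Ck_on_has_derivative[OF Suc.prems that] .
    show "Ck_on k S (\<lambda>x. L (frechet_derivative f (at x) v))" for v
      using Suc by simp
  qed
qed

context smooth_manifold
begin

lemma chart_open: "(U, \<phi>) \<in> atlas \<Longrightarrow> open (\<phi> ` U)"
  using atlas_chart by blast

lemma smooth_funI: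
  "(\<And>U \<phi> k. (U, \<phi>) \<in> atlas \<Longrightarrow> Ck_on k (\<phi> ` U) (\<lambda>x. f (inv_into U \<phi> x))) \<Longrightarrow> f \<in> smooth_fun"
  unfolding smooth_fun_def smooth_on_def o_def by auto

lemma smooth_funD:
  "f \<in> smooth_fun \<Longrightarrow> (U, \<phi>) \<in> atlas \<Longrightarrow> Ck_on k (\<phi> ` U) (\<lambda>x. f (inv_into U \<phi> x))"
  unfolding smooth_fun_def smooth_on_def o_def by fast

lemma smooth_fun_const: "(\<lambda>x. c) \<in> smooth_fun"
  by (intro smooth_funI Ck_on_const chart_open)

lemma smooth_fun_add: "f \<in> smooth_fun \<Longrightarrow> g \<in> smooth_fun \<Longrightarrow> (\<lambda>x. f x + g x) \<in> smooth_fun"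
  by (rule smooth_funI, rule Ck_on_add) (erule chart_open | erule (1) smooth_funD)+

lemma smooth_fun_bounded_linear:
  "bounded_linear L \<Longrightarrow> f \<in> smooth_fun \<Longrightarrow> (\<lambda>x. L (f x)) \<in> smooth_fun"
  by (rule smooth_funI, rule Ck_on_bounded_linear[of L]) (assumption | erule chart_open | erule (1) smooth_funD)+

lemma smooth_fun_bounded_bilinear:
  "bounded_bilinear B \<Longrightarrow> f \<in> smooth_fun \<Longrightarrow> g \<in> smooth_fun \<Longrightarrow> (\<lambda>x. B (f x) (g x)) \<in> smooth_fun"
  by (rule smooth_funI, rule Ck_on_bounded_bilinear[of B]) (assumption | erule chart_open | erule (1) smooth_funD)+

lemma smooth_fun_mult:
  fixes f g :: "'a \<Rightarrow> 'c::real_normed_algebra"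
  shows "f \<in> smooth_fun \<Longrightarrow> g \<in> smooth_fun \<Longrightarrow> (\<lambda>x. f x * g x) \<in> smooth_fun"
  by (rule smooth_fun_bounded_bilinear[OF bounded_bilinear_mult])

lemma smooth_fun_minus: "f \<in> smooth_fun \<Longrightarrow> (\<lambda>x. - f x) \<in> smooth_fun"
  by (rule smooth_fun_bounded_linear[OF bounded_linear_minus[OF bounded_linear_ident]])

lemma smooth_fun_diff: "f \<in> smooth_fun \<Longrightarrow> g \<in> smooth_fun \<Longrightarrow> (\<lambda>x. f x - g x) \<in> smooth_fun"
  using smooth_fun_add[OF _ smooth_fun_minus, of f g] by simp

lemma smooth_fun_of_real:
  "f \<in> smooth_fun \<Longrightarrow> (\<lambda>x. of_real (f x) :: complex) \<in> smooth_fun"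
  by (rule smooth_fun_bounded_linear[OF bounded_linear_of_real])

lemma smooth_fun_Re: "h \<in> smooth_fun \<Longrightarrow> (\<lambda>x. Re (h x)) \<in> smooth_fun"
  by (rule smooth_fun_bounded_linear[OF bounded_linear_Re])

lemma smooth_fun_Im: "h \<in> smooth_fun \<Longrightarrow> (\<lambda>x. Im (h x)) \<in> smooth_fun"
  by (rule smooth_fun_bounded_linear[OF bounded_linear_Im])

lemma smooth_fun_Complex:
  assumes "f \<in> smooth_fun" "g \<in> smooth_fun"
  shows "(\<lambda>x. Complex (f x) (g x)) \<in> smooth_fun"
  unfolding Complex_eq
  by (intro smooth_fun_add smooth_fun_mult smooth_fun_const smooth_fun_of_real assms)

lemmas smooth_intros = smooth_fun_const smooth_fun_add smooth_fun_mult smooth_fun_minus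
  smooth_fun_diff smooth_fun_of_real smooth_fun_Re smooth_fun_Im smooth_fun_Complex

section \<open>Tangent vectors and vector fields\<close>

lemma tangent_add:
  "v \<in> tangent_space x \<Longrightarrow> f \<in> smooth_fun \<Longrightarrow> g \<in> smooth_fun \<Longrightarrow> v (\<lambda>y. f y + g y) = v f + v g"
  unfolding tangent_space_def by (simp add: plus_fun_def)

lemma tangent_scale:
  "v \<in> tangent_space x \<Longrightarrow> f \<in> smooth_fun \<Longrightarrow> v (\<lambda>y. c * f y) = c * v f"
  unfolding tangent_space_def by simp

lemma tangent_mult:
  "v \<in> tangent_space x \<Longrightarrow> f \<in> smooth_fun \<Longrightarrow> g \<in> smooth_fun
    \<Longrightarrow> v (\<lambda>y. f y * g y) = f x * v g + g x * v f"
  unfolding tangent_space_def by simp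

lemma tangent_nonsmooth: "v \<in> tangent_space x \<Longrightarrow> f \<notin> smooth_fun \<Longrightarrow> v f = 0"
  unfolding tangent_space_def by simp

lemma tangent_minus:
  "v \<in> tangent_space x \<Longrightarrow> f \<in> smooth_fun \<Longrightarrow> v (\<lambda>y. - f y) = - v f"
  using tangent_scale[of v x f "-1"] by simp

lemma tangent_diff:
  "v \<in> tangent_space x \<Longrightarrow> f \<in> smooth_fun \<Longrightarrow> g \<in> smooth_fun \<Longrightarrow> v (\<lambda>y. f y - g y) = v f - v g"
  using tangent_add[of v x f "\<lambda>y. - g y"] by (simp add: tangent_minus smooth_fun_minus)

lemma tangent_const: 
  assumes "v \<in> tangent_space x" shows "v (\<lambda>y. c) = 0"
proof -
  have "v (\<lambda>y. 1 * 1) = 1 * v (\<lambda>y. 1) + 1 * v (\<lambda>y. 1)"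
    by (rule tangent_mult[OF assms]) (rule smooth_fun_const)+
  hence "v (\<lambda>y. 1) = 0" by simp
  then show ?thesis using tangent_scale[OF assms smooth_fun_const[of 1], of c] by simp
qed

lemma tangent_spaceI:
  assumes "\<And>f g. f \<in> smooth_fun \<Longrightarrow> g \<in> smooth_fun \<Longrightarrow> v (\<lambda>y. f y + g y) = v f + v g"
    and "\<And>c f. f \<in> smooth_fun \<Longrightarrow> v (\<lambda>y. c * f y) = c * v f"
    and "\<And>f g. f \<in> smooth_fun \<Longrightarrow> g \<in> smooth_fun \<Longrightarrow> v (\<lambda>y. f y * g y) = f x * v g + g x * v f"
    and "\<And>f. f \<notin> smooth_fun \<Longrightarrow> v f = 0"
  shows "v \<in> tangent_space x"
  unfolding tangent_space_def using assms by (simp add: plus_fun_def)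

lemma vf_tangent: "X \<in> vector_fields \<Longrightarrow> X x \<in> tangent_space x"
  unfolding vector_fields_def by simp

lemma vf_smooth: "X \<in> vector_fields \<Longrightarrow> f \<in> smooth_fun \<Longrightarrow> (\<lambda>x. X x f) \<in> smooth_fun"
  unfolding vector_fields_def by simp

lemmas vf_add = tangent_add[OF vf_tangent]
lemmas vf_scale = tangent_scale[OF vf_tangent]
lemmas vf_mult = tangent_mult[OF vf_tangent]
lemmas vf_nonsmooth = tangent_nonsmooth[OF vf_tangent]
lemmas vf_minus = tangent_minus[OF vf_tangent]
lemmas vf_diff = tangent_diff[OF vf_tangent]
lemmas vf_const = tangent_const[OF vf_tangent]

lemma vector_fieldsI:
  "(\<And>x. X x \<in> tangent_space x) \<Longrightarrow> (\<And>f. f \<in> smooth_fun \<Longrightarrow> (\<lambda>x. X x f) \<in> smooth_fun)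
    \<Longrightarrow> X \<in> vector_fields"
  unfolding vector_fields_def by simp

lemma vf_zero_closed: "0 \<in> vector_fields"
  by (intro vector_fieldsI tangent_spaceI) (auto simp: intro: smooth_intros)

lemma vf_add_closed: "X \<in> vector_fields \<Longrightarrow> Y \<in> vector_fields \<Longrightarrow> X + Y \<in> vector_fields"
  by (intro vector_fieldsI tangent_spaceI)
     (auto simp: vf_add vf_scale vf_mult vf_nonsmooth algebra_simps vf_smooth intro: smooth_intros)

lemma vf_fmult_closed: "f \<in> smooth_fun \<Longrightarrow> X \<in> vector_fields \<Longrightarrow> fmult f X \<in> vector_fields"
  unfolding fmult_def by (intro vector_fieldsI tangent_spaceI)
     (auto simp: vf_add vf_scale vf_mult vf_nonsmooth algebra_simps vf_smooth intro: smooth_intros)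

lemma fmult_const_minus: "fmult (\<lambda>x. -1) X = - X"
  by (simp add: fmult_def fun_eq_iff)

lemma fmult_const_one: "fmult (\<lambda>x. 1) X = X"
  by (simp add: fmult_def fun_eq_iff)

lemma vf_minus_closed: "X \<in> vector_fields \<Longrightarrow> - X \<in> vector_fields"
  using vf_fmult_closed[OF smooth_fun_const, of X "-1"] by (simp add: fmult_const_minus)

lemma vf_diff_closed: "X \<in> vector_fields \<Longrightarrow> Y \<in> vector_fields \<Longrightarrow> X - Y \<in> vector_fields"
  using vf_add_closed[OF _ vf_minus_closed, of X Y] by simp

lemma bracket_closed:
  assumes "X \<in> vector_fields" "Y \<in> vector_fields"
  shows "bracket X Y \<in> vector_fields"
  unfolding bracket_def using assms
  by (intro vector_fieldsI tangent_spaceI)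
     (auto simp: assms[THEN vf_add] assms[THEN vf_scale] assms[THEN vf_mult] assms[THEN vf_nonsmooth] vf_const algebra_simps assms[THEN vf_smooth]
       smooth_intros intro: smooth_intros)

lemmas vf_intros = vf_zero_closed vf_add_closed vf_fmult_closed vf_minus_closed vf_diff_closed
  bracket_closed

text \<open>On non-smooth functions all vector fields agree, by the convention that tangent vectors vanish there.\<close>

lemma vf_eqI:
  assumes "X \<in> vector_fields" "Y \<in> vector_fields" "\<And>x f. f \<in> smooth_fun \<Longrightarrow> X x f = Y x f"
  shows "X = Y"
proof (intro ext)
  show "X x f = Y x f" for x f
    using assms by (cases "f \<in> smooth_fun") (simp_all add: vf_nonsmooth)
qed

lemma bracket_fmult_add:
  assumes "f \<in> smooth_fun" "X \<in> vector_fields" "Y \<in> vector_fields" "Z \<in> vector_fields"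
  shows "bracket X (fmult f Y + Z) = fmult f (bracket X Y) + (fmult (\<lambda>x. X x f) Y + bracket X Z)"
  using assms
  by (intro vf_eqI vf_intros vf_smooth[OF assms(2,1)] assms)
     (auto simp: bracket_def fmult_def assms(2-4)[THEN vf_add] assms(2-4)[THEN vf_mult] assms(2-4)[THEN vf_smooth] smooth_intros algebra_simps)

lemma bracket_antisym: "bracket X Y = - bracket Y X"
  by (simp add: bracket_def fun_eq_iff)

lemma bracket_self: "bracket X X = 0"
  by (simp add: bracket_def fun_eq_iff)

lemma bracket_minus_right:
  assumes "X \<in> vector_fields" "Y \<in> vector_fields"
  shows "bracket X (- Y) = - bracket X Y"
  using assms
  by (intro vf_eqI vf_intros assms)
     (auto simp: bracket_def assms[THEN vf_minus] assms[THEN vf_smooth] smooth_intros algebra_simps)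

lemma bracket_minus_left:
  assumes "X \<in> vector_fields" "Y \<in> vector_fields"
  shows "bracket (- X) Y = - bracket X Y"
  by (simp add: bracket_antisym[of _ Y] bracket_minus_right assms)

lemma jacobi:
  assumes "X \<in> vector_fields" "Y \<in> vector_fields" "Z \<in> vector_fields"
  shows "bracket (bracket X Y) Z = bracket X (bracket Y Z) - bracket Y (bracket X Z)"
  using assms
  by (intro vf_eqI vf_intros assms)
     (auto simp: bracket_def assms[THEN vf_diff] assms[THEN vf_smooth] smooth_intros algebra_simps)

lemma vact_smooth:
  assumes "X \<in> vector_fields" "h \<in> smooth_fun"
  shows "vact X h \<in> smooth_fun"
  unfolding vact_def
  by (intro smooth_fun_Complex vf_smooth[OF assms(1)] smooth_fun_Re[OF assms(2)] smooth_fun_Im[OF assms(2)])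

lemma vact_add:
  assumes "X \<in> vector_fields" "h \<in> smooth_fun" "g \<in> smooth_fun"
  shows "vact X (\<lambda>x. h x + g x) y = vact X h y + vact X g y"
  using assms by (simp add: vact_def complex_eq_iff vf_add[OF assms(1)] smooth_fun_Re smooth_fun_Im)

lemma vact_mult:
  assumes "X \<in> vector_fields" "h \<in> smooth_fun" "g \<in> smooth_fun"
  shows "vact X (\<lambda>x. h x * g x) y = vact X h y * g y + h y * vact X g y"
  using assms
  by (simp add: vact_def complex_eq_iff assms(1)[THEN vf_diff] assms(1)[THEN vf_add]
      assms(1)[THEN vf_mult] smooth_fun_Re smooth_fun_Im smooth_fun_mult algebra_simps)

lemma vact_const: "X \<in> vector_fields \<Longrightarrow> vact X (\<lambda>x. c) = (\<lambda>x. 0)"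
  by (simp add: vact_def fun_eq_iff complex_eq_iff vf_const)

lemma vact_of_real:
  "X \<in> vector_fields \<Longrightarrow> vact X (\<lambda>x. of_real (f x)) = (\<lambda>x. of_real (X x f))"
  by (simp add: vact_def fun_eq_iff complex_eq_iff vf_const)

lemma vact_fmult_field: "vact (fmult f X) h x = of_real (f x) * vact X h x"
  by (simp add: vact_def fmult_def complex_eq_iff)

lemma vact_add_field: "vact (X + Y) h x = vact X h x + vact Y h x"
  by (simp add: vact_def complex_eq_iff)

lemma vact_bracket: "vact (bracket X Y) h x = vact X (vact Y h) x - vact Y (vact X h) x"
  by (simp add: vact_def bracket_def complex_eq_iff)

end

section \<open>Forms and the interior product\<close>

definition fscale :: "('a \<Rightarrow> complex) \<Rightarrow> 'a form \<Rightarrow> 'a form" where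
  "fscale h \<omega> = (\<lambda>Xs x. h x * \<omega> Xs x)"

lemma fscale_apply: "fscale h \<omega> Xs = (\<lambda>x. h x * \<omega> Xs x)"
  by (simp add: fscale_def)

lemma fscale_simps [simp]:
  "fscale h 0 = 0" "fscale (\<lambda>x. 0) \<omega> = 0" "fscale (\<lambda>x. 1) \<omega> = \<omega>" "fscale h (\<omega> + \<eta>) = fscale h \<omega> + fscale h \<eta>"
  "fscale h (\<omega> - \<eta>) = fscale h \<omega> - fscale h \<eta>" "fscale h (- \<omega>) = - fscale h \<omega>"
  "fscale (\<lambda>x. c) (fscale (\<lambda>x. c') \<omega>) = fscale (\<lambda>x. c * c') \<omega>"
  "fscale (\<lambda>x. - 1) \<omega> = - \<omega>"
  by (auto simp: fscale_def fun_eq_iff algebra_simps)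

lemma contract_apply: "contract X \<omega> Xs = \<omega> (X # Xs)"
  by (simp add: contract_def)

lemma contract_simps [simp]:
  "contract X 0 = 0" "contract X (\<omega> + \<eta>) = contract X \<omega> + contract X \<eta>"
  "contract X (\<omega> - \<eta>) = contract X \<omega> - contract X \<eta>" "contract X (- \<omega>) = - contract X \<omega>"
  "contract X (fscale h \<omega>) = fscale h (contract X \<omega>)"
  by (auto simp: fscale_def fun_eq_iff contract_def)

text \<open>The four patterns of omitted positions that occur in the Koszul formula when its first argument is split off.\<close>

lemma nths_omit:
  "nths (X # Xs) (- {0}) = Xs"
  "nths (X # Xs) (- {Suc i}) = X # nths Xs (- {i})"
  "nths (X # Xs) (- {0, Suc i}) = nths Xs (- {i})"
  "nths (X # Xs) (- {Suc i, Suc m}) = X # nths Xs (- {i, m})"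
proof -
  have "{j. Suc j \<in> - {Suc i}} = - {i}" "{j. Suc j \<in> - {0}} = UNIV"
    "{j. Suc j \<in> - {0, Suc i}} = - {i}" "{j. Suc j \<in> - {Suc i, Suc m}} = - {i, m}"
    by auto
  then show "nths (X # Xs) (- {0}) = Xs"
  "nths (X # Xs) (- {Suc i}) = X # nths Xs (- {i})"
  "nths (X # Xs) (- {0, Suc i}) = nths Xs (- {i})"
  "nths (X # Xs) (- {Suc i, Suc m}) = X # nths Xs (- {i, m})"
    unfolding nths_Cons by (simp_all add: nths_all)
qed

context smooth_manifold
begin

lemma formsI:
  assumes "\<And>Xs. set Xs \<subseteq> vector_fields \<Longrightarrow> length Xs = k \<Longrightarrow> \<omega> Xs \<in> smooth_fun"
    and "\<And>Xs. \<not> (set Xs \<subseteq> vector_fields \<and> length Xs = k) \<Longrightarrow> \<omega> Xs = 0"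
    and "\<And>Xs Ys f X Y. f \<in> smooth_fun \<Longrightarrow> X \<in> vector_fields \<Longrightarrow> Y \<in> vector_fields \<Longrightarrow>
        set Xs \<subseteq> vector_fields \<Longrightarrow> set Ys \<subseteq> vector_fields \<Longrightarrow> length Xs + length Ys + 1 = k \<Longrightarrow>
        \<omega> (Xs @ (fmult f X + Y) # Ys) =
          (\<lambda>x. complex_of_real (f x) * \<omega> (Xs @ X # Ys) x + \<omega> (Xs @ Y # Ys) x)"
    and "\<And>Xs i j. set Xs \<subseteq> vector_fields \<Longrightarrow> length Xs = k \<Longrightarrow> i < j \<Longrightarrow> j < k \<Longrightarrow> Xs ! i = Xs ! j
        \<Longrightarrow> \<omega> Xs = 0"
  shows "\<omega> \<in> forms k"
  unfolding forms_def mem_Collect_eq using assms by (intro conjI allI ballI impI) blast+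

lemma forms_outside: "\<omega> \<in> forms k \<Longrightarrow> \<not> (set Xs \<subseteq> vector_fields \<and> length Xs = k) \<Longrightarrow> \<omega> Xs = 0"
  unfolding forms_def by blast

lemma forms_smooth:
  assumes "\<omega> \<in> forms k"
  shows "\<omega> Xs \<in> smooth_fun"
proof (cases "set Xs \<subseteq> vector_fields \<and> length Xs = k")
  case True
  then show ?thesis using assms unfolding forms_def by blast
next
  case False
  then show ?thesis
    using forms_outside[OF assms False] smooth_fun_const[of 0] by (simp add: zero_fun_def)
qed

lemma forms_multilinear:
  assumes "\<omega> \<in> forms k" "f \<in> smooth_fun" "X \<in> vector_fields" "Y \<in> vector_fields"
  shows "\<omega> (Xs @ (fmult f X + Y) # Ys) x = of_real (f x) * \<omega> (Xs @ X # Ys) x + \<omega> (Xs @ Y # Ys) x"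
proof (cases "set Xs \<subseteq> vector_fields \<and> set Ys \<subseteq> vector_fields \<and> length Xs + length Ys + 1 = k")
  case True
  then have "\<omega> (Xs @ (fmult f X + Y) # Ys) =
          (\<lambda>x. complex_of_real (f x) * \<omega> (Xs @ X # Ys) x + \<omega> (Xs @ Y # Ys) x)"
    using assms unfolding forms_def by blast
  then show ?thesis by simp
next
  case False
  then have "\<omega> (Xs @ Z # Ys) = 0" for Z
    by (intro forms_outside[OF assms(1)]) auto
  then show ?thesis by simp
qed

lemma forms_alternating:
  assumes "\<omega> \<in> forms k" "i < j" "j < length Xs" "Xs ! i = Xs ! j"
  shows "\<omega> Xs = 0"
proof (cases "set Xs \<subseteq> vector_fields \<and> length Xs = k")
  case True
  then show ?thesis using assms unfolding forms_def by blast
next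
  case False
  then show ?thesis by (rule forms_outside[OF assms(1)])
qed

lemma zero_form: "0 \<in> forms k"
  using smooth_fun_const[of 0] by (intro formsI) (auto simp: zero_fun_def)

lemma add_form:
  assumes "\<omega> \<in> forms k" "\<eta> \<in> forms k"
  shows "\<omega> + \<eta> \<in> forms k"
proof (rule formsI)
  show "(\<omega> + \<eta>) Xs \<in> smooth_fun" for Xs
    using smooth_fun_add[OF forms_smooth[OF assms(1)] forms_smooth[OF assms(2)]] by (simp add: plus_fun_def)
  show "(\<omega> + \<eta>) (Xs @ (fmult f X + Y) # Ys)
      = (\<lambda>x. complex_of_real (f x) * (\<omega> + \<eta>) (Xs @ X # Ys) x + (\<omega> + \<eta>) (Xs @ Y # Ys) x)"
    if "f \<in> smooth_fun" "X \<in> vector_fields" "Y \<in> vector_fields" for Xs Ys f X Y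
    by (simp add: fun_eq_iff forms_multilinear[OF assms(1) that] forms_multilinear[OF assms(2) that] distrib_left)
qed (simp_all add: fun_eq_iff forms_outside[OF assms(1)] forms_outside[OF assms(2)]
    forms_alternating[OF assms(1)] forms_alternating[OF assms(2)])

lemma fscale_form:
  assumes "\<omega> \<in> forms k" "h \<in> smooth_fun"
  shows "fscale h \<omega> \<in> forms k"
proof (rule formsI)
  show "fscale h \<omega> Xs \<in> smooth_fun" for Xs
    unfolding fscale_apply by (intro smooth_fun_mult assms forms_smooth[OF assms(1)])
  show "fscale h \<omega> (Xs @ (fmult f X + Y) # Ys)
      = (\<lambda>x. complex_of_real (f x) * fscale h \<omega> (Xs @ X # Ys) x + fscale h \<omega> (Xs @ Y # Ys) x)"
    if "f \<in> smooth_fun" "X \<in> vector_fields" "Y \<in> vector_fields" for Xs Ys f X Y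
    by (simp add: fun_eq_iff fscale_def forms_multilinear[OF assms(1) that] distrib_left)
qed (simp_all add: fscale_def fun_eq_iff forms_outside[OF assms(1)] forms_alternating[OF assms(1)])

lemma cscale_form: "\<omega> \<in> forms k \<Longrightarrow> fscale (\<lambda>x. c) \<omega> \<in> forms k"
  by (rule fscale_form[OF _ smooth_fun_const])

lemma minus_form: "\<omega> \<in> forms k \<Longrightarrow> - \<omega> \<in> forms k"
  using cscale_form[of \<omega> k "-1"] by simp

lemma diff_form: "\<omega> \<in> forms k \<Longrightarrow> \<eta> \<in> forms k \<Longrightarrow> \<omega> - \<eta> \<in> forms k"
  using add_form[OF _ minus_form, of \<omega> k \<eta>] by simp

lemma contract_outside: "\<omega> \<in> forms k \<Longrightarrow> X \<notin> vector_fields \<Longrightarrow> contract X \<omega> = 0"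
  by (auto simp: fun_eq_iff contract_def forms_outside)

lemma contract_form:
  assumes "\<omega> \<in> forms k" 
  shows "contract X \<omega> \<in> forms (k - 1)"
proof (cases "X \<in> vector_fields \<and> k \<noteq> 0")
  case False
  then have "contract X \<omega> = 0"
    using assms contract_outside by (auto simp: fun_eq_iff contract_def forms_outside)
  then show ?thesis by (simp add: zero_form)
next
  case True
  show ?thesis
  proof (rule formsI)
    show "contract X \<omega> Xs \<in> smooth_fun" for Xs
      unfolding contract_apply by (rule forms_smooth[OF assms])
    show "contract X \<omega> (Xs @ (fmult f Z + Y) # Ys) =
          (\<lambda>x. complex_of_real (f x) * contract X \<omega> (Xs @ Z # Ys) x + contract X \<omega> (Xs @ Y # Ys) x)"
      if "f \<in> smooth_fun" "Z \<in> vector_fields" "Y \<in> vector_fields" for Xs Ys f Z Y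
      using forms_multilinear[OF assms that, of "X # Xs" Ys] by (simp add: contract_def fun_eq_iff)
    show "contract X \<omega> Xs = 0" if "i < j" "j < k - 1" "length Xs = k - 1" "Xs ! i = Xs ! j" for i j Xs
      using forms_alternating[OF assms, of "Suc i" "Suc j" "X # Xs"] that by (simp add: contract_def)
    show "contract X \<omega> Xs = 0" if "\<not> (set Xs \<subseteq> vector_fields \<and> length Xs = k - 1)" for Xs
      using forms_outside[OF assms, of "X # Xs"] that True by (force simp: contract_def)
  qed
qed

lemma contract_linear:
  assumes "\<omega> \<in> forms k" "f \<in> smooth_fun" "X \<in> vector_fields" "Y \<in> vector_fields"
  shows "contract (fmult f X + Y) \<omega> = fscale (\<lambda>x. of_real (f x)) (contract X \<omega>) + contract Y \<omega>"
  using forms_multilinear[OF assms, of "[]"] by (simp add: fun_eq_iff contract_def fscale_def)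

lemma contract_add_left:
  assumes "\<omega> \<in> forms k" "X \<in> vector_fields" "Y \<in> vector_fields"
  shows "contract (X + Y) \<omega> = contract X \<omega> + contract Y \<omega>"
  using contract_linear[OF assms(1) smooth_fun_const[of 1] assms(2,3)] by (simp add: fmult_const_one)

lemma contract_zero_left:
  assumes "\<omega> \<in> forms k"
  shows "contract 0 \<omega> = 0"
  using contract_add_left[OF assms vf_zero_closed vf_zero_closed] by simp

lemma contract_fmult_left:
  assumes "\<omega> \<in> forms k" "f \<in> smooth_fun" "X \<in> vector_fields"
  shows "contract (fmult f X) \<omega> = fscale (\<lambda>x. of_real (f x)) (contract X \<omega>)"
  using contract_linear[OF assms vf_zero_closed] contract_zero_left[OF assms(1)] by simp

lemma contract_minus_left:
  assumes "\<omega> \<in> forms k" "X \<in> vector_fields"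
  shows "contract (- X) \<omega> = - contract X \<omega>"
  using contract_fmult_left[OF assms(1) smooth_fun_const[of "-1"] assms(2)]
  by (simp add: fmult_const_minus)

lemma contract_diff_left:
  assumes "\<omega> \<in> forms k" "X \<in> vector_fields" "Y \<in> vector_fields"
  shows "contract (X - Y) \<omega> = contract X \<omega> - contract Y \<omega>"
  using contract_add_left[OF assms(1,2) vf_minus_closed[OF assms(3)]] contract_minus_left[OF assms(1,3)]
  by simp

lemma contract_self: "\<omega> \<in> forms k \<Longrightarrow> contract X (contract X \<omega>) = 0"
  using forms_alternating[of \<omega> k 0 1] by (simp add: fun_eq_iff contract_def)

lemma contract_swap:
  assumes "\<omega> \<in> forms k" "X \<in> vector_fields" "Y \<in> vector_fields"
  shows "contract X (contract Y \<omega>) = - contract Y (contract X \<omega>)"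
proof -
  note c = contract_add_left[OF assms] contract_add_left[OF contract_form[OF assms(1)] assms(2,3)]
  have "contract (X + Y) (contract (X + Y) \<omega>) = 0"
    by (rule contract_self[OF assms(1)])
  then have "contract Y (contract X \<omega>) + contract X (contract Y \<omega>) = 0"
    by (simp add: c contract_self[OF assms(1)] add.commute)
  then show ?thesis unfolding add_eq_0_iff .
qed

lemma form_swap:
  "\<omega> \<in> forms k \<Longrightarrow> X \<in> vector_fields \<Longrightarrow> Y \<in> vector_fields \<Longrightarrow> \<omega> (X # Y # Xs) = - \<omega> (Y # X # Xs)"
  using contract_swap[of \<omega> k Y X] by (simp add: contract_def fun_eq_iff)

lemma form_move_to_front:
  assumes "\<omega> \<in> forms k" "set Xs \<subseteq> vector_fields" "X \<in> vector_fields"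
  shows "\<omega> (Xs @ X # Ys) x = (-1) ^ length Xs * \<omega> (X # Xs @ Ys) x"
  using assms
proof (induction Xs arbitrary: \<omega> k)
  case (Cons A Xs)
  have "\<omega> ((A # Xs) @ X # Ys) x = (-1) ^ length Xs * \<omega> (A # X # Xs @ Ys) x"
    using Cons.IH[OF contract_form[OF Cons.prems(1)], of A] Cons.prems by (simp add: contract_def)
  then show ?case using form_swap[of \<omega> k A X "Xs @ Ys"] Cons.prems by simp
qed simp

text \<open>The sign is that of moving the argument from the front to position \<open>j\<close>. It turns the bracket terms
of the Koszul formula into the terms of the Lie derivative.\<close>

lemma form_insert_at:
  assumes "\<omega> \<in> forms k" "set Xs \<subseteq> vector_fields" "X \<in> vector_fields" "j < length Xs"
  shows "\<omega> (X # nths Xs (- {j})) x = (-1) ^ j * \<omega> (Xs[j := X]) x"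
  using assms
proof (induction Xs arbitrary: \<omega> k j)
  case (Cons A Xs)
  show ?case
  proof (cases j)
    case 0
    then show ?thesis by (simp add: nths_omit)
  next
    case (Suc n)
    have "\<omega> (X # A # nths Xs (- {n})) x = - contract A \<omega> (X # nths Xs (- {n})) x"
      using form_swap[of \<omega> k X A] Cons.prems by (simp add: contract_def)
    also have "\<dots> = - ((-1) ^ n) * \<omega> (A # Xs[n := X]) x"
      using Cons.IH[OF contract_form[OF Cons.prems(1)], of n A] Cons.prems Suc by (simp add: contract_def)
    finally show ?thesis by (simp add: nths_omit Suc)
  qed
qed simp

text \<open>A form of degree \<open>k + 1\<close> is a family of forms of degree \<open>k\<close>, linear in its parameter, that vanishes on two
equal leading arguments: alternation in other pairs of positions follows by moving arguments to the
front. This is the criterion by which operators are shown to preserve forms, inductively in the degree.\<close>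

lemma forms_SucI:
  assumes empty: "\<omega> [] = 0"
    and outside: "\<And>X. X \<notin> vector_fields \<Longrightarrow> contract X \<omega> = 0"
    and tail: "\<And>X. X \<in> vector_fields \<Longrightarrow> contract X \<omega> \<in> forms k"
    and linear: "\<And>f X Y. f \<in> smooth_fun \<Longrightarrow> X \<in> vector_fields \<Longrightarrow> Y \<in> vector_fields \<Longrightarrow>
      contract (fmult f X + Y) \<omega> = fscale (\<lambda>x. of_real (f x)) (contract X \<omega>) + contract Y \<omega>"
    and alt: "\<And>X. X \<in> vector_fields \<Longrightarrow> contract X (contract X \<omega>) = 0"
  shows "\<omega> \<in> forms (Suc k)"
proof (rule formsI)
  have eq: "\<omega> (X # Xs) = contract X \<omega> Xs" for X Xs by (simp add: contract_def)
  show "\<omega> Xs \<in> smooth_fun" if "set Xs \<subseteq> vector_fields" "length Xs = Suc k" for Xs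
    using that by (cases Xs) (auto simp: eq intro: forms_smooth tail)
  show "\<omega> Xs = 0" if "\<not> (set Xs \<subseteq> vector_fields \<and> length Xs = Suc k)" for Xs
  proof (cases Xs)
    case (Cons X Ys)
    then show ?thesis
    proof (cases "X \<in> vector_fields")
      case True
      then show ?thesis using forms_outside[OF tail[OF True], of Ys] that Cons by (auto simp: eq)
    qed (simp add: eq outside)
  qed (simp add: empty)
  show "\<omega> (Xs @ (fmult f X + Y) # Ys) =
          (\<lambda>x. complex_of_real (f x) * \<omega> (Xs @ X # Ys) x + \<omega> (Xs @ Y # Ys) x)"
    if "f \<in> smooth_fun" "X \<in> vector_fields" "Y \<in> vector_fields" "set Xs \<subseteq> vector_fields" for f X Y Xs Ys
  proof (cases Xs)
    case Nil
    then show ?thesis using linear[OF that(1-3)] by (simp add: eq fscale_def fun_eq_iff)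
  next
    case (Cons Z Zs)
    then show ?thesis using forms_multilinear[OF tail that(1-3), of Z Zs Ys] that by (simp add: eq fun_eq_iff)
  qed
  show "\<omega> Xs = 0" if "set Xs \<subseteq> vector_fields" "length Xs = Suc k" "i < j" "j < Suc k" "Xs ! i = Xs ! j" for Xs i j
  proof (cases Xs)
    case Nil
    then show ?thesis using empty by simp
  next
    case (Cons X Ys)
    hence X: "X \<in> vector_fields" using that by simp
    define m where "m = j - 1"
    have m: "j = Suc m" using that(3) by (simp add: m_def)
    show ?thesis
    proof (cases i)
      case (Suc n)
      then show ?thesis using that forms_alternating[OF tail[OF X], of n m Ys] Cons m by (simp add: eq)
    next
      \<comment> \<open>The repeated entry at position \<open>j\<close> is moved next to the one at position \<open>0\<close>.\<close>
      case 0
      have Ym: "X = Ys ! m" "m < length Ys" using that 0 Cons m by auto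
      have Ys: "Ys = take m Ys @ X # drop (Suc m) Ys" unfolding Ym(1) by (rule id_take_nth_drop[OF Ym(2)])
      have "set (take m Ys) \<subseteq> vector_fields" using that Cons set_take_subset by fastforce
      from form_move_to_front[OF tail[OF X] this X, of "drop (Suc m) Ys"] alt[OF X]
      have "contract X \<omega> (take m Ys @ X # drop (Suc m) Ys) x = 0" for x
        by (simp add: contract_def fun_eq_iff)
      then show ?thesis using Ys Cons by (simp add: eq fun_eq_iff)
    qed
  qed
qed

lemma form_0_contract: "\<omega> \<in> forms 0 \<Longrightarrow> contract X \<omega> = 0"
  by (simp add: fun_eq_iff contract_def forms_outside)

section \<open>Cartan calculus\<close>

lemma lie_form_Nil: "lie_form X \<omega> [] = vact X (\<omega> [])"
  by (simp add: lie_form_def fun_eq_iff)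

lemma lie_form_outside: "\<not> set Xs \<subseteq> vector_fields \<Longrightarrow> lie_form X \<omega> Xs = 0"
  by (simp add: lie_form_def fun_eq_iff)

lemma ext_d_Nil: "ext_d \<omega> [] = 0"
  by (simp add: ext_d_def fun_eq_iff)

lemma ext_d_outside: "\<not> set Xs \<subseteq> vector_fields \<Longrightarrow> ext_d \<omega> Xs = 0"
  by (simp add: ext_d_def fun_eq_iff)

lemma contract_lie_form:
  assumes "\<omega> \<in> forms k" "Y \<in> vector_fields"
  shows "contract Y (lie_form X \<omega>) = lie_form X (contract Y \<omega>) - contract (bracket X Y) \<omega>"
proof (intro ext)
  fix Xs x
  show "contract Y (lie_form X \<omega>) Xs x = (lie_form X (contract Y \<omega>) - contract (bracket X Y) \<omega>) Xs x"
    using assms forms_outside[OF assms(1), of "bracket X Y # Xs"]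
    by (auto simp: contract_def lie_form_def sum.lessThan_Suc_shift simp del: sum.lessThan_Suc)
qed

text \<open>Splitting off the first argument of the Koszul formula leaves, besides the Koszul formula of
\<open>contract X \<omega>\<close> with the opposite sign, the terms in which \<open>X\<close> acts as a derivation or sits in a bracket; these
make up the Lie derivative.\<close>

lemma cartan_formula:
  assumes "\<omega> \<in> forms k" "X \<in> vector_fields"
  shows "contract X (ext_d \<omega>) = lie_form X \<omega> - ext_d (contract X \<omega>)"
proof (intro ext)
  fix Xs x
  show "contract X (ext_d \<omega>) Xs x = (lie_form X \<omega> - ext_d (contract X \<omega>)) Xs x"
  proof (cases "set Xs \<subseteq> vector_fields")
    case False
    then show ?thesis by (simp add: contract_def lie_form_outside ext_d_outside)
  next
    case True
    have nth: "Xs ! i \<in> vector_fields" if "i < length Xs" for i using that True by auto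
    have move: "\<omega> (bracket X (Xs ! i) # nths Xs (- {i})) x = (-1) ^ i * \<omega> (Xs[i := bracket X (Xs ! i)]) x"
      if "i < length Xs" for i
      by (rule form_insert_at[OF assms(1) True bracket_closed[OF assms(2) nth[OF that]] that])
    have swap: "\<omega> (bracket (Xs ! i) (Xs ! j) # X # nths Xs A) x = - \<omega> (X # bracket (Xs ! i) (Xs ! j) # nths Xs A) x"
      if "i < j" "j < length Xs" for i j A
      using form_swap[OF assms(1) bracket_closed[OF nth nth] assms(2), of i j] that by simp
    \<comment> \<open>In \<open>A\<close>, \<open>B\<close> and \<open>C\<close>: the derivation terms of the other arguments, the brackets with \<open>X\<close>,
      and the brackets of the other arguments among each other.\<close>
    have A: "(\<Sum>i<length Xs. (-1) ^ Suc i * vact (Xs ! i) (\<omega> (X # nths Xs (- {i}))) x)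
        = - (\<Sum>i<length Xs. (-1) ^ i * vact (Xs ! i) (contract X \<omega> (nths Xs (- {i}))) x)"
      by (simp add: contract_def sum_negf)
    have B: "(\<Sum>j<length Xs. (-1) ^ Suc j * \<omega> (bracket X (Xs ! j) # nths Xs (- {j})) x)
        = - (\<Sum>j<length Xs. \<omega> (Xs[j := bracket X (Xs ! j)]) x)"
      unfolding sum_negf[symmetric] by (intro sum.cong) (auto simp: move simp flip: power_add mult.assoc)
    have C: "(\<Sum>j<length Xs. \<Sum>i<j. (-1) ^ (Suc i + Suc j) * \<omega> (bracket (Xs ! i) (Xs ! j) # X # nths Xs (- {i, j})) x)
        = - (\<Sum>j<length Xs. \<Sum>i<j. (-1) ^ (i + j) * contract X \<omega> (bracket (Xs ! i) (Xs ! j) # nths Xs (- {i, j})) x)"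
      unfolding sum_negf[symmetric] by (intro sum.cong) (auto simp: swap contract_def)
    have "contract X (ext_d \<omega>) Xs x = vact X (\<omega> Xs) x
        + (\<Sum>i<length Xs. (-1) ^ Suc i * vact (Xs ! i) (\<omega> (X # nths Xs (- {i}))) x)
        + (\<Sum>j<length Xs. (-1) ^ Suc j * \<omega> (bracket X (Xs ! j) # nths Xs (- {j})) x)
        + (\<Sum>j<length Xs. \<Sum>i<j. (-1) ^ (Suc i + Suc j) * \<omega> (bracket (Xs ! i) (Xs ! j) # X # nths Xs (- {i, j})) x)"
      using True assms(2)
      by (simp add: contract_def ext_d_def sum.lessThan_Suc_shift nths_omit sum.distrib sum_subtractf sum_negf
          del: sum.lessThan_Suc)
    also have "\<dots> = (lie_form X \<omega> - ext_d (contract X \<omega>)) Xs x"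
      unfolding A B C using True by (simp add: lie_form_def ext_d_def algebra_simps)
    finally show ?thesis .
  qed
qed

lemma Cons_contract: "\<omega> (X # Xs) = contract X \<omega> Xs"
  by (simp add: contract_def)

lemma lie_form_zero: "X \<in> vector_fields \<Longrightarrow> lie_form X 0 = 0"
  by (simp add: lie_form_def fun_eq_iff vact_const zero_fun_def)

lemma lie_form_add:
  assumes "X \<in> vector_fields" "\<omega> \<in> forms k" "\<eta> \<in> forms k"
  shows "lie_form X (\<omega> + \<eta>) = lie_form X \<omega> + lie_form X \<eta>"
  using vact_add[OF assms(1) forms_smooth[OF assms(2)] forms_smooth[OF assms(3)]]
  by (simp add: lie_form_def fun_eq_iff sum.distrib plus_fun_def)

lemma lie_form_fscale:
  assumes "X \<in> vector_fields" "\<omega> \<in> forms k" "h \<in> smooth_fun"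
  shows "lie_form X (fscale h \<omega>) = fscale (vact X h) \<omega> + fscale h (lie_form X \<omega>)"
  using vact_mult[OF assms(1,3) forms_smooth[OF assms(2)]] forms_outside[OF assms(2)]
  by (auto simp: lie_form_def fun_eq_iff fscale_def algebra_simps sum_distrib_left)

lemma lie_form_cscale:
  assumes "X \<in> vector_fields" "\<omega> \<in> forms k"
  shows "lie_form X (fscale (\<lambda>x. c) \<omega>) = fscale (\<lambda>x. c) (lie_form X \<omega>)"
  using lie_form_fscale[OF assms smooth_fun_const] by (simp add: vact_const assms(1))

lemma lie_form_minus:
  "X \<in> vector_fields \<Longrightarrow> \<omega> \<in> forms k \<Longrightarrow> lie_form X (- \<omega>) = - lie_form X \<omega>"
  using lie_form_cscale[of X \<omega> k "-1"] by simp

lemma lie_form_diff: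
  "X \<in> vector_fields \<Longrightarrow> \<omega> \<in> forms k \<Longrightarrow> \<eta> \<in> forms k \<Longrightarrow> lie_form X (\<omega> - \<eta>) = lie_form X \<omega> - lie_form X \<eta>"
  using lie_form_add[of X \<omega> k "- \<eta>"] by (simp add: lie_form_minus minus_form)

lemma lie_form_form:
  assumes "X \<in> vector_fields"
  shows "\<omega> \<in> forms k \<Longrightarrow> lie_form X \<omega> \<in> forms k"
proof (induction k arbitrary: \<omega>)
  case 0
  have "lie_form X \<omega> (Y # Ys) = 0" for Y Ys
    using contract_lie_form[OF 0, of Y X] form_0_contract[OF 0] 
      lie_form_outside[of "Y # Ys" X \<omega>]
    by (cases "Y \<in> vector_fields") (auto simp: Cons_contract lie_form_zero[OF assms])
  then have ne: "lie_form X \<omega> Ys = 0" if "Ys \<noteq> []" for Ys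
    using that by (cases Ys) auto
  show ?case
  proof (rule formsI)
    show "lie_form X \<omega> Xs \<in> smooth_fun" if "length Xs = 0" for Xs
      using vact_smooth[OF assms forms_smooth[OF 0]] that by (simp add: lie_form_Nil)
    show "lie_form X \<omega> Xs = 0" if "\<not> (set Xs \<subseteq> vector_fields \<and> length Xs = 0)" for Xs
      using that by (intro ne) auto
  qed auto
next
  case (Suc k)
  note c = contract_lie_form[OF Suc.prems]
  have cf: "contract Y \<omega> \<in> forms k" for Y using contract_form[OF Suc.prems, of Y] by simp
  show ?case
  proof (rule forms_SucI)
    have "\<omega> [] = (\<lambda>x. 0)" using forms_outside[OF Suc.prems, of "[]"] by (simp add: zero_fun_def)
    then show "lie_form X \<omega> [] = 0"
      using assms by (simp add: lie_form_Nil vact_const zero_fun_def)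
    show "contract Y (lie_form X \<omega>) = 0" if "Y \<notin> vector_fields" for Y
      using that lie_form_outside by (auto simp: contract_def fun_eq_iff)
    show "contract Y (lie_form X \<omega>) \<in> forms k" if "Y \<in> vector_fields" for Y
      unfolding c[OF that] by (intro diff_form Suc.IH cf)
    show "contract (fmult f Y + Z) (lie_form X \<omega>)
        = fscale (\<lambda>x. complex_of_real (f x)) (contract Y (lie_form X \<omega>)) + contract Z (lie_form X \<omega>)"
      if fYZ: "f \<in> smooth_fun" "Y \<in> vector_fields" "Z \<in> vector_fields" for f Y Z
    proof -
      have br: "contract (bracket X (fmult f Y + Z)) \<omega> = fscale (\<lambda>x. complex_of_real (f x)) (contract (bracket X Y) \<omega>)
          + (fscale (\<lambda>x. of_real (X x f)) (contract Y \<omega>) + contract (bracket X Z) \<omega>)"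
        unfolding bracket_fmult_add[OF fYZ(1) assms fYZ(2,3)]
        using fYZ assms by (simp add: contract_linear[OF Suc.prems] vf_intros vf_smooth)
      show ?thesis
        using fYZ assms
        by (simp add: c vf_intros br contract_linear[OF Suc.prems] lie_form_add[of _ _ k] lie_form_fscale[OF _ cf]
            fscale_form cf smooth_fun_of_real vact_of_real)
    qed
    show "contract Y (contract Y (lie_form X \<omega>)) = 0" if "Y \<in> vector_fields" for Y
      using contract_swap[OF Suc.prems that bracket_closed[OF assms that]]
      by (simp add: c[OF that] contract_lie_form[OF cf that] contract_self[OF Suc.prems] lie_form_zero[OF assms])
  qed
qed

text \<open>Operators are compared on all forms of a class \<open>C\<close> at once, by induction on the list of arguments. The
contraction of the two sides is typically an expression in the same operators applied to
\<open>contract X \<omega>\<close>, which is again in \<open>C\<close>.\<close>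

lemma form_operator_eqI:
  assumes "\<And>\<omega>. \<omega> \<in> C \<Longrightarrow> A \<omega> [] = B \<omega> []"
    and "\<And>\<omega> X Xs. \<omega> \<in> C \<Longrightarrow> X \<notin> vector_fields \<Longrightarrow> A \<omega> (X # Xs) = B \<omega> (X # Xs)"
    and "\<And>\<omega> X Xs. \<omega> \<in> C \<Longrightarrow> X \<in> vector_fields \<Longrightarrow> (\<And>\<eta>. \<eta> \<in> C \<Longrightarrow> A \<eta> Xs = B \<eta> Xs)
      \<Longrightarrow> contract X (A \<omega>) Xs = contract X (B \<omega>) Xs"
    and "\<omega> \<in> C"
  shows "A \<omega> = B \<omega>"
proof
  show "A \<omega> Xs = B \<omega> Xs" for Xs
    using assms(4)
  proof (induction Xs arbitrary: \<omega>)
    case (Cons X Xs)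
    then show ?case
      using assms(2,3) by (cases "X \<in> vector_fields") (auto simp: Cons_contract)
  qed (rule assms(1))
qed

lemma ext_d_zero: "ext_d 0 = 0"
proof (rule form_operator_eqI[where C = "{0}" and A = ext_d and B = "\<lambda>\<omega>. \<omega>"])
  fix \<omega> :: "'a form" and X and Xs :: "'a vfield list"
  assume "\<omega> \<in> {0}" "X \<in> vector_fields" and IH: "\<And>\<eta>. \<eta> \<in> {0} \<Longrightarrow> ext_d \<eta> Xs = \<eta> Xs"
  then show "contract X (ext_d \<omega>) Xs = contract X \<omega> Xs"
    using IH[of 0] by (simp add: cartan_formula[OF zero_form] lie_form_zero)
qed (auto simp: ext_d_Nil ext_d_outside)

lemma ext_d_add:
  assumes "\<omega> \<in> forms k" "\<eta> \<in> forms k"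
  shows "ext_d (\<omega> + \<eta>) = ext_d \<omega> + ext_d \<eta>"
proof -
  have "(\<lambda>(\<omega>, \<eta>). ext_d (\<omega> + \<eta>)) (\<omega>, \<eta>) = (\<lambda>(\<omega>, \<eta>). ext_d \<omega> + ext_d \<eta>) (\<omega>, \<eta>)"
  proof (rule form_operator_eqI[where C = "\<Union>k. forms k \<times> forms k"])
    fix p :: "'a form \<times> 'a form" and X and Xs :: "'a vfield list"
    assume "p \<in> (\<Union>k. forms k \<times> forms k)" and X: "X \<in> vector_fields"
      and IH: "\<And>p. p \<in> (\<Union>k. forms k \<times> forms k) \<Longrightarrow> (\<lambda>(\<omega>, \<eta>). ext_d (\<omega> + \<eta>)) p Xs = (\<lambda>(\<omega>, \<eta>). ext_d \<omega> + ext_d \<eta>) p Xs"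
    then obtain \<omega> \<eta> k where p: "p = (\<omega>, \<eta>)" and f: "\<omega> \<in> forms k" "\<eta> \<in> forms k" by auto
    have "ext_d (contract X \<omega> + contract X \<eta>) Xs = (ext_d (contract X \<omega>) + ext_d (contract X \<eta>)) Xs"
      using IH[of "(contract X \<omega>, contract X \<eta>)"] contract_form[OF f(1)] contract_form[OF f(2)] by auto
    then show "contract X ((\<lambda>(\<omega>, \<eta>). ext_d (\<omega> + \<eta>)) p) Xs = contract X ((\<lambda>(\<omega>, \<eta>). ext_d \<omega> + ext_d \<eta>) p) Xs"
      by (simp add: p cartan_formula[OF add_form[OF f] X] cartan_formula[OF _ X] f lie_form_add[OF X f]
          cartan_formula[OF f(1) X] cartan_formula[OF f(2) X])
  qed (use assms in \<open>auto simp: ext_d_Nil ext_d_outside\<close>)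
  then show ?thesis by simp
qed

lemma ext_d_cscale:
  assumes "\<omega> \<in> forms k"
  shows "ext_d (fscale (\<lambda>x. c) \<omega>) = fscale (\<lambda>x. c) (ext_d \<omega>)"
proof (rule form_operator_eqI[where C = "\<Union>k. forms k"
    and A = "\<lambda>\<omega>. ext_d (fscale (\<lambda>x. c) \<omega>)"
    and B = "\<lambda>\<omega>. fscale (\<lambda>x. c) (ext_d \<omega>)"])
  fix \<omega> :: "'a form" and X and Xs :: "'a vfield list"
  assume "\<omega> \<in> (\<Union>k. forms k)" and X: "X \<in> vector_fields"
    and IH: "\<And>\<eta>. \<eta> \<in> (\<Union>k. forms k) \<Longrightarrow> ext_d (fscale (\<lambda>x. c) \<eta>) Xs = fscale (\<lambda>x. c) (ext_d \<eta>) Xs"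
  then obtain k where f: "\<omega> \<in> forms k" by auto
  show "contract X (ext_d (fscale (\<lambda>x. c) \<omega>)) Xs = contract X (fscale (\<lambda>x. c) (ext_d \<omega>)) Xs"
    using IH[of "contract X \<omega>"] contract_form[OF f]
    by (auto simp add: cartan_formula[OF cscale_form[OF f] X] cartan_formula[OF f X] lie_form_cscale[OF X f])
qed (use assms in \<open>auto simp: ext_d_Nil ext_d_outside fscale_apply fun_eq_iff\<close>)

lemma ext_d_minus: "\<omega> \<in> forms k \<Longrightarrow> ext_d (- \<omega>) = - ext_d \<omega>"
  using ext_d_cscale[of \<omega> k "-1"] by simp

lemma ext_d_diff: "\<omega> \<in> forms k \<Longrightarrow> \<eta> \<in> forms k \<Longrightarrow> ext_d (\<omega> - \<eta>) = ext_d \<omega> - ext_d \<eta>"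
  using ext_d_add[of \<omega> k "- \<eta>"] by (simp add: ext_d_minus minus_form)

text \<open>Since contractions anticommute, the second differential in Cartan's formula can be absorbed into the
contraction of \<open>ext_d (contract Y \<omega>)\<close>. The result expresses a property of \<open>\<lambda>X. contract X (ext_d \<omega>)\<close>
through the same property for the form \<open>contract Y \<omega>\<close>.\<close>

lemma contract_contract_ext_d:
  assumes "\<omega> \<in> forms k" "X \<in> vector_fields" "Y \<in> vector_fields"
  shows "contract Y (contract X (ext_d \<omega>))
    = contract X (ext_d (contract Y \<omega>)) - contract (bracket X Y) \<omega> - lie_form Y (contract X \<omega>)"
proof -
  have "contract X (ext_d (contract Y \<omega>)) = lie_form X (contract Y \<omega>) + ext_d (contract Y (contract X \<omega>))"
    using contract_swap[OF assms] ext_d_minus[OF contract_form[OF contract_form[OF assms(1)]], of Y X]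
    by (simp add: cartan_formula[OF contract_form[OF assms(1)] assms(2)])
  then show ?thesis
    by (simp add: cartan_formula[OF assms(1,2)] contract_lie_form[OF assms(1,3)]
        cartan_formula[OF contract_form[OF assms(1)] assms(3)])
qed

text \<open>When a further field \<open>Z\<close> is contracted, the coefficient \<open>f\<close> is differentiated along \<open>Z\<close> twice, once in the
bracket with \<open>Z\<close> and once in the Lie derivative along \<open>Z\<close>; the two contributions cancel.\<close>

lemma contract_ext_d_linear:
  assumes fXY: "f \<in> smooth_fun" "X \<in> vector_fields" "Y \<in> vector_fields" and "\<omega> \<in> forms k"
  shows "contract (fmult f X + Y) (ext_d \<omega>)
    = fscale (\<lambda>x. of_real (f x)) (contract X (ext_d \<omega>)) + contract Y (ext_d \<omega>)"
proof (rule form_operator_eqI[where C = "\<Union>k. forms k"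
    and A = "\<lambda>\<omega>. contract (fmult f X + Y) (ext_d \<omega>)"
    and B = "\<lambda>\<omega>. fscale (\<lambda>x. of_real (f x)) (contract X (ext_d \<omega>)) + contract Y (ext_d \<omega>)"])
  let ?V = "fmult f X + Y"
  have V: "?V \<in> vector_fields" by (intro vf_intros fXY)
  fix \<omega> :: "'a form" and Z and Xs :: "'a vfield list"
  {
    assume "\<omega> \<in> (\<Union>k. forms k)"
    then obtain k where f: "\<omega> \<in> forms k" by auto
    show "contract ?V (ext_d \<omega>) [] = (fscale (\<lambda>x. of_real (f x)) (contract X (ext_d \<omega>)) + contract Y (ext_d \<omega>)) []"
      by (simp add: cartan_formula[OF f] V fXY lie_form_Nil ext_d_Nil fscale_apply fun_eq_iff
          vact_fmult_field vact_add_field)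
  next
    assume "\<omega> \<in> (\<Union>k. forms k)" and Z: "Z \<in> vector_fields"
      and IH: "\<And>\<eta>. \<eta> \<in> (\<Union>k. forms k) \<Longrightarrow> contract ?V (ext_d \<eta>) Xs
         = (fscale (\<lambda>x. of_real (f x)) (contract X (ext_d \<eta>)) + contract Y (ext_d \<eta>)) Xs"
    then obtain k where f: "\<omega> \<in> forms k" by auto
    note cf = contract_form[OF f]
    have br: "contract (bracket ?V Z) \<omega> = fscale (\<lambda>x. of_real (f x)) (contract (bracket X Z) \<omega>)
        - fscale (\<lambda>x. of_real (Z x f)) (contract X \<omega>) + contract (bracket Y Z) \<omega>"
    proof -
      have "contract (bracket ?V Z) \<omega> = - contract (bracket Z ?V) \<omega>"
        unfolding bracket_antisym[of ?V Z] by (intro contract_minus_left[OF f] bracket_closed Z V)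
      also have "contract (bracket Z ?V) \<omega> = fscale (\<lambda>x. of_real (f x)) (contract (bracket Z X) \<omega>)
          + (fscale (\<lambda>x. of_real (Z x f)) (contract X \<omega>) + contract (bracket Z Y) \<omega>)"
        unfolding bracket_fmult_add[OF fXY(1) Z fXY(2,3)]
        using fXY Z by (simp add: contract_linear[OF f] vf_intros vf_smooth)
      finally have *: "contract (bracket ?V Z) \<omega> = - (fscale (\<lambda>x. of_real (f x)) (contract (bracket Z X) \<omega>)
          + (fscale (\<lambda>x. of_real (Z x f)) (contract X \<omega>) + contract (bracket Z Y) \<omega>))" .
      have swap: "contract (bracket W Z) \<omega> = - contract (bracket Z W) \<omega>" if "W \<in> vector_fields" for W
        unfolding bracket_antisym[of W Z] by (intro contract_minus_left[OF f] bracket_closed Z that)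
      show ?thesis
        unfolding * swap[OF fXY(2)] swap[OF fXY(3)] by simp
    qed
    have lie: "lie_form Z (contract ?V \<omega>) = fscale (\<lambda>x. of_real (Z x f)) (contract X \<omega>)
        + fscale (\<lambda>x. of_real (f x)) (lie_form Z (contract X \<omega>)) + lie_form Z (contract Y \<omega>)"
      using fXY Z
      by (simp add: contract_linear[OF f] lie_form_add[OF Z fscale_form[OF cf] cf] lie_form_fscale[OF Z cf]
          smooth_fun_of_real vact_of_real)
    have "contract Z \<omega> \<in> (\<Union>k. forms k)" using cf by blast
    from IH[OF this] show "contract Z (contract ?V (ext_d \<omega>)) Xs
        = contract Z (fscale (\<lambda>x. of_real (f x)) (contract X (ext_d \<omega>)) + contract Y (ext_d \<omega>)) Xs"
      by (simp add: contract_contract_ext_d[OF f] V Z fXY br lie)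
  next
    assume "\<omega> \<in> (\<Union>k. forms k)" "Z \<notin> vector_fields"
    then show "contract ?V (ext_d \<omega>) (Z # Xs)
       = (fscale (\<lambda>x. of_real (f x)) (contract X (ext_d \<omega>)) + contract Y (ext_d \<omega>)) (Z # Xs)"
      by (simp add: contract_apply ext_d_outside fscale_apply fun_eq_iff)
  }
qed (use assms in auto)

lemma ext_d_form: "\<omega> \<in> forms k \<Longrightarrow> ext_d \<omega> \<in> forms (Suc k)"
proof (induction k arbitrary: \<omega>)
  case 0
  show ?case
  proof (rule forms_SucI)
    show "contract X (contract X (ext_d \<omega>)) = 0" if "X \<in> vector_fields" for X
      by (simp add: contract_contract_ext_d[OF 0 that that] form_0_contract[OF 0] ext_d_zero lie_form_zero that)
    show "contract X (ext_d \<omega>) \<in> forms 0" if "X \<in> vector_fields" for X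
      by (simp add: cartan_formula[OF 0 that] form_0_contract[OF 0] ext_d_zero lie_form_form[OF that 0])
  qed (auto simp: ext_d_Nil contract_apply ext_d_outside fun_eq_iff contract_ext_d_linear[OF _ _ _ 0])
next
  case (Suc k)
  have cf: "contract X \<omega> \<in> forms k" for X using contract_form[OF Suc.prems, of X] by simp
  show ?case
  proof (rule forms_SucI)
    show "contract X (contract X (ext_d \<omega>)) = 0" if "X \<in> vector_fields" for X
      by (simp add: contract_contract_ext_d[OF Suc.prems that that] cartan_formula[OF cf that] bracket_self
          contract_zero_left[OF Suc.prems] contract_self[OF Suc.prems] ext_d_zero)
    show "contract X (ext_d \<omega>) \<in> forms (Suc k)" if "X \<in> vector_fields" for X
      unfolding cartan_formula[OF Suc.prems that]
      by (intro diff_form lie_form_form that Suc.prems Suc.IH cf)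
  qed (auto simp: ext_d_Nil contract_apply ext_d_outside fun_eq_iff contract_ext_d_linear[OF _ _ _ Suc.prems])
qed

text \<open>On functions this is the definition of the bracket; contraction reduces higher degrees to lower
ones by the Jacobi identity.\<close>

lemma lie_form_bracket:
  assumes X: "X \<in> vector_fields" and Y: "Y \<in> vector_fields" and "\<omega> \<in> forms k"
  shows "lie_form (bracket X Y) \<omega> = lie_form X (lie_form Y \<omega>) - lie_form Y (lie_form X \<omega>)"
proof (rule form_operator_eqI[where C = "\<Union>k. forms k"
    and A = "\<lambda>\<omega>. lie_form (bracket X Y) \<omega>"
    and B = "\<lambda>\<omega>. lie_form X (lie_form Y \<omega>) - lie_form Y (lie_form X \<omega>)"])
  fix \<omega> :: "'a form" and Z and Xs :: "'a vfield list"
  assume "\<omega> \<in> (\<Union>k. forms k)" and Z: "Z \<in> vector_fields"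
    and IH: "\<And>\<eta>. \<eta> \<in> (\<Union>k. forms k) \<Longrightarrow> lie_form (bracket X Y) \<eta> Xs
      = (lie_form X (lie_form Y \<eta>) - lie_form Y (lie_form X \<eta>)) Xs"
  then obtain k where f: "\<omega> \<in> forms k" by auto
  note cf = contract_form[OF f]
  have j: "contract (bracket (bracket X Y) Z) \<omega>
      = contract (bracket X (bracket Y Z)) \<omega> - contract (bracket Y (bracket X Z)) \<omega>"
    using X Y Z by (simp add: jacobi contract_diff_left[OF f] vf_intros)
  have "contract Z \<omega> \<in> (\<Union>k. forms k)" using cf by blast
  from IH[OF this] show "contract Z (lie_form (bracket X Y) \<omega>) Xs
      = contract Z (lie_form X (lie_form Y \<omega>) - lie_form Y (lie_form X \<omega>)) Xs"
    using X Y Z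
    by (simp add: contract_lie_form[OF f] contract_lie_form[OF lie_form_form[OF _ f]] vf_intros
        lie_form_diff[OF _ lie_form_form[OF _ cf] cf] j)
qed (use assms in \<open>auto simp: lie_form_Nil vact_bracket lie_form_outside fun_eq_iff\<close>)

text \<open>By Cartan's formula the contraction of the difference of the two sides is, up to sign, that difference for
the contracted form plus the defect of the bracket formula for Lie derivatives, which is zero.\<close>

lemma lie_form_ext_d:
  assumes X: "X \<in> vector_fields" and "\<omega> \<in> forms k"
  shows "lie_form X (ext_d \<omega>) = ext_d (lie_form X \<omega>)"
proof (rule form_operator_eqI[where C = "\<Union>k. forms k"
    and A = "\<lambda>\<omega>. lie_form X (ext_d \<omega>)"
    and B = "\<lambda>\<omega>. ext_d (lie_form X \<omega>)"])
  fix \<omega> :: "'a form" and Y and Xs :: "'a vfield list"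
  assume "\<omega> \<in> (\<Union>k. forms k)" and Y: "Y \<in> vector_fields"
    and IH: "\<And>\<eta>. \<eta> \<in> (\<Union>k. forms k) \<Longrightarrow> lie_form X (ext_d \<eta>) Xs = ext_d (lie_form X \<eta>) Xs"
  then obtain k where f: "\<omega> \<in> forms k" by auto
  note cf = contract_form[OF f]
  note XY = bracket_closed[OF X Y]
  have "contract Y \<omega> \<in> (\<Union>k. forms k)" using cf by blast
  note IH' = IH[OF this]
  have l: "contract Y (lie_form X (ext_d \<omega>)) = lie_form X (lie_form Y \<omega>) - lie_form X (ext_d (contract Y \<omega>))
      - (lie_form (bracket X Y) \<omega> - ext_d (contract (bracket X Y) \<omega>))"
  proof (cases k)
    case 0
    with f have "contract Y \<omega> = 0" by (simp add: form_0_contract)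
    then show ?thesis
      by (simp add: contract_lie_form[OF ext_d_form[OF f] Y] cartan_formula[OF f] XY Y ext_d_zero lie_form_zero X)
  next
    case (Suc m)
    with ext_d_form[OF cf, of Y] have "ext_d (contract Y \<omega>) \<in> forms k" by simp
    from lie_form_diff[OF X lie_form_form[OF Y f] this] show ?thesis
      by (simp add: contract_lie_form[OF ext_d_form[OF f] Y] cartan_formula[OF f] XY Y)
  qed
  have r: "contract Y (ext_d (lie_form X \<omega>)) = lie_form Y (lie_form X \<omega>)
      - (ext_d (lie_form X (contract Y \<omega>)) - ext_d (contract (bracket X Y) \<omega>))"
    by (simp add: cartan_formula[OF lie_form_form[OF X f] Y] contract_lie_form[OF f Y]
        ext_d_diff[OF lie_form_form[OF X cf] cf])
  show "contract Y (lie_form X (ext_d \<omega>)) Xs = contract Y (ext_d (lie_form X \<omega>)) Xs"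
    unfolding l r using IH' by (simp add: lie_form_bracket[OF X Y f])
qed (use assms in \<open>auto simp: lie_form_Nil ext_d_Nil vact_const zero_fun_def lie_form_outside ext_d_outside fun_eq_iff\<close>)

text \<open>\<open>\<iota>\<^sub>X d d = L\<^sub>X d - d \<iota>\<^sub>X d = L\<^sub>X d - d L\<^sub>X + d d \<iota>\<^sub>X\<close>, where the first two terms cancel.\<close>

lemma ext_d_ext_d:
  assumes "\<omega> \<in> forms k"
  shows "ext_d (ext_d \<omega>) = 0"
proof (rule form_operator_eqI[where C = "\<Union>k. forms k"
    and A = "\<lambda>\<omega>. ext_d (ext_d \<omega>)"
    and B = "\<lambda>\<omega>. 0"])
  fix \<omega> :: "'a form" and X and Xs :: "'a vfield list"
  assume "\<omega> \<in> (\<Union>k. forms k)" and X: "X \<in> vector_fields"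
    and IH: "\<And>\<eta>. \<eta> \<in> (\<Union>k. forms k) \<Longrightarrow> ext_d (ext_d \<eta>) Xs = 0 Xs"
  then obtain k where f: "\<omega> \<in> forms k" by auto
  note cf = contract_form[OF f]
  have "contract X \<omega> \<in> (\<Union>k. forms k)" using cf by blast
  note IH' = IH[OF this]
  have "ext_d (lie_form X \<omega> - ext_d (contract X \<omega>)) = ext_d (lie_form X \<omega>) - ext_d (ext_d (contract X \<omega>))"
  proof (cases k)
    case 0
    with f have "contract X \<omega> = 0" by (simp add: form_0_contract)
    then show ?thesis by (simp add: ext_d_zero)
  next
    case (Suc m)
    with ext_d_form[OF cf, of X] have "ext_d (contract X \<omega>) \<in> forms k" by simp
    then show ?thesis by (rule ext_d_diff[OF lie_form_form[OF X f]])
  qed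
  then show "contract X (ext_d (ext_d \<omega>)) Xs = contract X 0 Xs"
    using IH' by (simp add: cartan_formula[OF ext_d_form[OF f] X] cartan_formula[OF f X] lie_form_ext_d[OF X f])
qed (use assms in \<open>auto simp: ext_d_Nil ext_d_outside\<close>)

end

section \<open>Types of forms as eigenspaces\<close>

abbreviation cscale :: "complex \<Rightarrow> 'a form \<Rightarrow> 'a form" where
  "cscale c \<equiv> fscale (\<lambda>x. c)"

lemma cscale_zero [simp]: "cscale 0 \<omega> = 0"
  by (simp add: fscale_def fun_eq_iff)

text \<open>Contraction with the complex vector field that the pair represents.\<close>

definition icontract :: "'a vfield \<times> 'a vfield \<Rightarrow> 'a form \<Rightarrow> 'a form" where
  "icontract Z \<omega> = contract (fst Z) \<omega> + cscale \<i> (contract (snd Z) \<omega>)"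

lemma icontract_simps [simp]:
  "icontract Z 0 = 0" "icontract Z (\<omega> + \<eta>) = icontract Z \<omega> + icontract Z \<eta>"
  "icontract Z (\<omega> - \<eta>) = icontract Z \<omega> - icontract Z \<eta>" "icontract Z (- \<omega>) = - icontract Z \<omega>"
  "icontract Z (cscale c \<omega>) = cscale c (icontract Z \<omega>)"
  by (simp_all add: icontract_def algebra_simps)

lemma complexify_add: "complexify Zs (\<omega> + \<eta>) = complexify Zs \<omega> + complexify Zs \<eta>"
  by (induction Zs arbitrary: \<omega> \<eta>) (auto simp: fun_eq_iff algebra_simps)

lemma complexify_cscale: "complexify Zs (cscale c \<omega>) = (\<lambda>x. c * complexify Zs \<omega> x)"
  by (induction Zs arbitrary: \<omega>) (auto simp: fun_eq_iff algebra_simps fscale_apply)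

lemma complexify_zero: "complexify Zs 0 = 0"
  using complexify_cscale[of Zs 0 0] by (simp add: fun_eq_iff)

lemma complexify_diff: "complexify Zs (\<omega> - \<eta>) = complexify Zs \<omega> - complexify Zs \<eta>"
  using complexify_add[of Zs "\<omega> - \<eta>" \<eta>] by simp

lemma complexify_Cons_icontract: "complexify (Z # Zs) \<omega> = complexify Zs (icontract Z \<omega>)"
  by (simp add: icontract_def complexify_add complexify_cscale fun_eq_iff)

declare complexify.simps(2) [simp del]

context smooth_manifold
begin

lemma form_eqI:
  assumes "\<omega> \<in> forms k" "\<eta> \<in> forms k" "\<omega> [] = \<eta> []"
    and "\<And>X. X \<in> vector_fields \<Longrightarrow> contract X \<omega> = contract X \<eta>"
  shows "\<omega> = \<eta>"
proof
  show "\<omega> Xs = \<eta> Xs" for Xs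
  proof (cases Xs)
    case (Cons X Ys)
    then show ?thesis
      using assms(4)[of X] contract_outside[OF assms(1), of X] contract_outside[OF assms(2), of X]
      by (cases "X \<in> vector_fields") (simp_all add: Cons_contract)
  qed (simp add: assms(3))
qed

lemma icontract_form: "\<omega> \<in> forms k \<Longrightarrow> icontract Z \<omega> \<in> forms (k - 1)"
  unfolding icontract_def by (intro add_form cscale_form contract_form)

lemma icontract_swap:
  assumes "\<omega> \<in> forms k" "{fst Z, snd Z, fst W, snd W} \<subseteq> vector_fields"
  shows "icontract Z (icontract W \<omega>) = - icontract W (icontract Z \<omega>)"
proof -
  have s: "contract X (contract Y \<omega>) = - contract Y (contract X \<omega>)"
    if "X \<in> {fst Z, snd Z}" "Y \<in> {fst W, snd W}" for X Y
    using contract_swap[OF assms(1), of X Y] assms(2) that by blast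
  show ?thesis
    by (simp add: icontract_def s algebra_simps)
qed

end

context almost_complex_manifold
begin

lemma jv_add: "X \<in> vector_fields \<Longrightarrow> Y \<in> vector_fields \<Longrightarrow> jv (X + Y) = jv X + jv Y"
  by (simp add: japply_def fun_eq_iff J_add vf_tangent)

lemma jv_fmult: "X \<in> vector_fields \<Longrightarrow> jv (fmult f X) = fmult f (jv X)"
  by (simp add: japply_def fmult_def J_scale vf_tangent)

lemma jv_minus: "X \<in> vector_fields \<Longrightarrow> jv (- X) = - jv X"
  using jv_fmult[of X "\<lambda>x. -1"] by (simp add: fmult_const_minus)

lemma jv_diff: "X \<in> vector_fields \<Longrightarrow> Y \<in> vector_fields \<Longrightarrow> jv (X - Y) = jv X - jv Y"
  using jv_add[of X "- Y"] by (simp add: jv_minus vf_minus_closed)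

lemma jv_jv: "X \<in> vector_fields \<Longrightarrow> jv (jv X) = - X"
  by (simp add: japply_def fun_eq_iff J_square vf_tangent)

lemma jv_zero: "jv 0 = 0"
  using jv_diff[OF vf_zero_closed vf_zero_closed] by simp

lemmas jv_intros = vf_intros J_smooth

text \<open>A field of type \<open>(0,1)\<close> or \<open>(1,0)\<close> is determined by its real part, which may be arbitrary.\<close>

lemma T01_iff: "Z \<in> T01 \<longleftrightarrow> (\<exists>X\<in>vector_fields. Z = (X, jv X))"
  unfolding T01_def by (auto simp: jv_jv J_smooth)

lemma T10_iff: "Z \<in> T10 \<longleftrightarrow> (\<exists>X\<in>vector_fields. Z = (X, - jv X))"
proof
  show "Z \<in> T10" if "\<exists>X\<in>vector_fields. Z = (X, - jv X)"
    using that unfolding T10_def by (auto simp: jv_minus jv_jv jv_intros)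
  show "\<exists>X\<in>vector_fields. Z = (X, - jv X)" if "Z \<in> T10"
    using that unfolding T10_def by auto
qed

text \<open>Up to the factor \<open>-\<i>\<close>, this is the extension of \<open>j\<close> to forms as a derivation. The factor makes the
eigenvalues integers: an argument of type \<open>(1,0)\<close> contributes \<open>1\<close> and one of type \<open>(0,1)\<close> contributes \<open>-1\<close>.\<close>

definition weight :: "'a form \<Rightarrow> 'a form" where
  "weight \<omega> = (\<lambda>Xs x. if set Xs \<subseteq> vector_fields
     then - \<i> * (\<Sum>i<length Xs. \<omega> (Xs[i := jv (Xs ! i)]) x) else 0)"

lemma weight_Nil: "weight \<omega> [] = 0"
  by (simp add: weight_def fun_eq_iff)

lemma weight_outside: "\<not> set Xs \<subseteq> vector_fields \<Longrightarrow> weight \<omega> Xs = 0"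
  by (simp add: weight_def fun_eq_iff)

lemma weight_simps [simp]:
  "weight 0 = 0" "weight (\<omega> + \<eta>) = weight \<omega> + weight \<eta>"
  "weight (\<omega> - \<eta>) = weight \<omega> - weight \<eta>" "weight (- \<omega>) = - weight \<omega>"
  "weight (fscale h \<omega>) = fscale h (weight \<omega>)"
  by (auto simp: weight_def fun_eq_iff fscale_apply sum.distrib sum_subtractf sum_negf
      sum_distrib_left algebra_simps)

lemma contract_weight:
  assumes "\<omega> \<in> forms k" "Y \<in> vector_fields"
  shows "contract Y (weight \<omega>) = weight (contract Y \<omega>) - cscale \<i> (contract (jv Y) \<omega>)"
proof (intro ext)
  fix Xs x
  show "contract Y (weight \<omega>) Xs x = (weight (contract Y \<omega>) - cscale \<i> (contract (jv Y) \<omega>)) Xs x"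
    using assms forms_outside[OF assms(1), of "jv Y # Xs"]
    by (auto simp: contract_def weight_def fscale_apply sum.lessThan_Suc_shift algebra_simps
        simp del: sum.lessThan_Suc)
qed

lemma weight_form: "\<omega> \<in> forms k \<Longrightarrow> weight \<omega> \<in> forms k"
proof (induction k arbitrary: \<omega>)
  case 0
  have "weight \<omega> = 0"
  proof
    show "weight \<omega> Xs = 0 Xs" for Xs
      using contract_weight[OF 0, of "hd Xs"] form_0_contract[OF 0] weight_outside[of Xs \<omega>]
      by (cases Xs; cases "hd Xs \<in> vector_fields") (auto simp: weight_Nil Cons_contract)
  qed
  then show ?case by (simp only: zero_form)
next
  case (Suc k)
  note c = contract_weight[OF Suc.prems]
  have cf: "contract Y \<omega> \<in> forms k" for Y using contract_form[OF Suc.prems, of Y] by simp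
  show ?case
  proof (rule forms_SucI)
    show "contract Y (weight \<omega>) = 0" if "Y \<notin> vector_fields" for Y
      using that weight_outside by (auto simp: contract_def fun_eq_iff)
    show "contract Y (weight \<omega>) \<in> forms k" if "Y \<in> vector_fields" for Y
      unfolding c[OF that] by (intro diff_form cscale_form Suc.IH cf)
    show "contract (fmult f Y + Z) (weight \<omega>)
        = fscale (\<lambda>x. complex_of_real (f x)) (contract Y (weight \<omega>)) + contract Z (weight \<omega>)"
      if "f \<in> smooth_fun" "Y \<in> vector_fields" "Z \<in> vector_fields" for f Y Z
      using that
      by (simp add: c jv_intros jv_add jv_fmult contract_linear[OF Suc.prems])
        (simp add: fscale_def fun_eq_iff algebra_simps)
    show "contract Y (contract Y (weight \<omega>)) = 0" if "Y \<in> vector_fields" for Y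
      using contract_swap[OF Suc.prems that J_smooth[OF that]]
      by (simp add: c[OF that] contract_weight[OF cf that] contract_self[OF Suc.prems])
  qed (rule weight_Nil)
qed

lemma icontract_weight_T10:
  assumes "\<omega> \<in> forms k" "Z \<in> T10"
  shows "icontract Z (weight \<omega>) = weight (icontract Z \<omega>) + icontract Z \<omega>"
proof -
  obtain X where X: "X \<in> vector_fields" "Z = (X, - jv X)" using assms(2) T10_iff by auto
  show ?thesis
    by (simp add: X icontract_def contract_weight[OF assms(1)] contract_minus_left[OF assms(1)] jv_intros
        jv_minus jv_jv algebra_simps)
qed

lemma icontract_weight_T01:
  assumes "\<omega> \<in> forms k" "Z \<in> T01"
  shows "icontract Z (weight \<omega>) = weight (icontract Z \<omega>) - icontract Z \<omega>"
proof -
  obtain X where X: "X \<in> vector_fields" "Z = (X, jv X)" using assms(2) T01_iff by auto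
  show ?thesis
    by (simp add: X icontract_def contract_weight[OF assms(1)] contract_minus_left[OF assms(1)] jv_intros
        jv_jv algebra_simps)
qed

lemma complexify_weight:
  assumes "\<omega> \<in> forms k" "set Zs \<subseteq> T10" "set Ws \<subseteq> T01"
    and "length Zs + length Ws = k"
  shows "complexify (Zs @ Ws) (weight \<omega>) x
    = (of_nat (length Zs) - of_nat (length Ws)) * complexify (Zs @ Ws) \<omega> x"
  using assms
proof (induction k arbitrary: \<omega> Zs Ws)
  case 0
  then show ?case by (simp add: weight_Nil)
next
  case (Suc k)
  note f = Suc.prems(1)
  have cf: "icontract Z \<omega> \<in> forms k" for Z using icontract_form[OF f, of Z] by simp
  show ?case
  proof (cases Zs)
    case (Cons Z Zs')
    have "complexify (Zs' @ Ws) (weight (icontract Z \<omega>)) x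
      = (of_nat (length Zs') - of_nat (length Ws)) * complexify (Zs' @ Ws) (icontract Z \<omega>) x"
      by (rule Suc.IH[OF cf]) (use Suc.prems Cons in auto)
    then show ?thesis
      using Suc.prems Cons icontract_weight_T10[OF f, of Z]
      by (simp add: complexify_Cons_icontract complexify_add algebra_simps)
  next
    case Nil
    then obtain W Ws' where W: "Ws = W # Ws'" using Suc.prems by (cases Ws) auto
    have "complexify Ws' (weight (icontract W \<omega>)) x = - of_nat (length Ws') * complexify Ws' (icontract W \<omega>) x"
      using Suc.IH[OF cf, of "[]" Ws'] Suc.prems Nil W by auto
    moreover have "icontract W (weight \<omega>) = weight (icontract W \<omega>) - icontract W \<omega>"
      using Suc.prems W by (intro icontract_weight_T01[OF f]) auto
    ultimately show ?thesis
      using Nil W by (simp add: complexify_Cons_icontract complexify_diff) (simp add: algebra_simps)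
  qed
qed

lemma T10_T01_fields:
  "Z \<in> T10 \<union> T01 \<Longrightarrow> fst Z \<in> vector_fields" "Z \<in> T10 \<union> T01 \<Longrightarrow> snd Z \<in> vector_fields"
  unfolding T10_def T01_def by auto

lemma complexify_move_to_front:
  assumes "\<omega> \<in> forms k" "set Zs \<subseteq> T10 \<union> T01" "W \<in> T10 \<union> T01"
  shows "complexify (Zs @ W # Ws) \<omega> x = (-1) ^ length Zs * complexify (W # Zs @ Ws) \<omega> x"
  using assms
proof (induction Zs arbitrary: \<omega> k)
  case (Cons Z Zs)
  have "icontract W (icontract Z \<omega>) = - icontract Z (icontract W \<omega>)"
    using Cons.prems T10_T01_fields by (intro icontract_swap[OF Cons.prems(1)]) auto
  then show ?case
    using Cons.IH[OF icontract_form[OF Cons.prems(1)], of Z] Cons.prems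
      complexify_diff[of "Zs @ Ws" 0 "icontract Z (icontract W \<omega>)"]
    by (simp add: complexify_Cons_icontract complexify_zero)
qed simp

text \<open>Every real field \<open>X\<close> is half the sum of the fields \<open>X - \<i> jX\<close> of type \<open>(1,0)\<close> and \<open>X + \<i> jX\<close> of type \<open>(0,1)\<close>,
and contraction with either of them leaves a form of lower degree to which the induction hypothesis applies.\<close>

lemma form_eq_0_if_complexify:
  assumes "\<omega> \<in> forms k"
    and "\<And>Zs Ws. set Zs \<subseteq> T10 \<Longrightarrow> set Ws \<subseteq> T01 \<Longrightarrow> length Zs + length Ws = k
      \<Longrightarrow> complexify (Zs @ Ws) \<omega> = 0"
  shows "\<omega> = 0"
  using assms
proof (induction k arbitrary: \<omega>)
  case 0
  show ?case
    using 0(2)[of "[]" "[]"] form_0_contract[OF 0(1)] by (intro form_eqI[OF 0(1) zero_form]) auto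
next
  case (Suc k)
  note f = Suc.prems(1)
  have cf: "icontract Z \<omega> \<in> forms k" for Z using icontract_form[OF f, of Z] by simp
  show ?case
  proof (rule form_eqI[OF f zero_form])
    show "\<omega> [] = 0 []" using forms_outside[OF f, of "[]"] by simp
    fix X assume X: "X \<in> vector_fields"
    have "icontract (X, - jv X) \<omega> = 0"
    proof (rule Suc.IH[OF cf])
      fix Zs Ws assume "set Zs \<subseteq> T10" "set Ws \<subseteq> T01" "length Zs + length Ws = k"
      then show "complexify (Zs @ Ws) (icontract (X, - jv X) \<omega>) = 0"
        using Suc.prems(2)[of "(X, - jv X) # Zs" Ws] X by (auto simp: T10_iff complexify_Cons_icontract)
    qed
    moreover have "icontract (X, jv X) \<omega> = 0"
    proof (rule Suc.IH[OF cf])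
      fix Zs Ws assume *: "set Zs \<subseteq> T10" "set Ws \<subseteq> T01" "length Zs + length Ws = k"
      have W: "(X, jv X) \<in> T01" using X T01_iff by auto
      have "complexify (Zs @ (X, jv X) # Ws) \<omega> = 0"
        using Suc.prems(2)[of Zs "(X, jv X) # Ws"] W * by auto
      then show "complexify (Zs @ Ws) (icontract (X, jv X) \<omega>) = 0"
        using complexify_move_to_front[OF f, of Zs "(X, jv X)" Ws] W * 
        by (auto simp: complexify_Cons_icontract fun_eq_iff)
    qed
    ultimately have "icontract (X, - jv X) \<omega> + icontract (X, jv X) \<omega> = 0" by simp
    then show "contract X \<omega> = contract X 0"
      using X by (simp add: icontract_def contract_minus_left[OF f] J_smooth fun_eq_iff)
  qed
qed

text \<open>The difference of the two sides of the eigenvalue equation is a form, hence determined by its values on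
fields of pure type, where \<open>weight\<close> is known. Because eigenvalues of a given degree determine the type,
the equivalence remains valid for negative \<open>p\<close> or \<open>q\<close>, where it says that there are no such
eigenforms except \<open>0\<close>.\<close>

lemma Omega_iff_weight:
  assumes "0 \<le> p + q"
  shows "\<omega> \<in> Omega p q \<longleftrightarrow> \<omega> \<in> forms (nat (p + q)) \<and> weight \<omega> = cscale (of_int (p - q)) \<omega>"
    (is "_ \<longleftrightarrow> ?E")
proof
  have len: "(of_nat (length Zs) - of_nat (length Ws) :: complex) = of_int (p - q) \<longleftrightarrow> int (length Zs) = p"
    if "length Zs + length Ws = nat (p + q)" for Zs Ws :: "('a vfield \<times> 'a vfield) list"
  proof -
    have eq: "(of_nat (length Zs) - of_nat (length Ws) :: complex) = of_int (int (length Zs) - int (length Ws))"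
      by simp
    show ?thesis unfolding eq of_int_eq_iff using that assms by linarith
  qed
  have vanish: "complexify (Zs @ Ws) \<omega> = 0"
    if "?E" "set Zs \<subseteq> T10" "set Ws \<subseteq> T01" "length Zs + length Ws = nat (p + q)" "int (length Zs) \<noteq> p" for Zs Ws
  proof
    fix x
    have "(of_nat (length Zs) - of_nat (length Ws)) * complexify (Zs @ Ws) \<omega> x
        = of_int (p - q) * complexify (Zs @ Ws) \<omega> x"
      using that by (simp add: complexify_weight[of \<omega> "nat (p + q)", symmetric] complexify_cscale del: mult_cancel_right)
    moreover have "(of_nat (length Zs) - of_nat (length Ws) :: complex) \<noteq> of_int (p - q)"
      using len[OF that(4)] that(5) by blast
    ultimately show "complexify (Zs @ Ws) \<omega> x = 0 x" using mult_right_cancel by auto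
  qed
  show "\<omega> \<in> Omega p q" if E: "?E"
  proof (cases "p < 0 \<or> q < 0")
    case True
    have "\<omega> = 0"
    proof (rule form_eq_0_if_complexify)
      fix Zs Ws assume *: "set Zs \<subseteq> T10" "set Ws \<subseteq> T01" "length Zs + length Ws = nat (p + q)"
      moreover have "int (length Zs) \<noteq> p" using * True assms by linarith
      ultimately show "complexify (Zs @ Ws) \<omega> = 0" by (rule vanish[OF E])
    qed (use E in blast)
    then show ?thesis using True by (simp add: Omega_def)
  next
    case False
    have "complexify (Zs @ Ws) \<omega> = 0"
      if "set Zs \<subseteq> T10" "set Ws \<subseteq> T01" "int (length Zs + length Ws) = p + q" "int (length Zs) \<noteq> p" for Zs Ws
      using that E by (intro vanish) auto
    then show ?thesis unfolding Omega_def using False E by auto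
  qed
  show "?E" if O: "\<omega> \<in> Omega p q"
  proof (cases "p < 0 \<or> q < 0")
    case True
    then show ?thesis using O by (simp add: Omega_def zero_form)
  next
    case False
    with O have f: "\<omega> \<in> forms (nat (p + q))" by (simp add: Omega_def)
    have "weight \<omega> - cscale (of_int (p - q)) \<omega> = 0"
    proof (rule form_eq_0_if_complexify)
      show "weight \<omega> - cscale (of_int (p - q)) \<omega> \<in> forms (nat (p + q))"
        by (intro diff_form weight_form cscale_form f)
      fix Zs Ws assume *: "set Zs \<subseteq> T10" "set Ws \<subseteq> T01" "length Zs + length Ws = nat (p + q)"
      show "complexify (Zs @ Ws) (weight \<omega> - cscale (of_int (p - q)) \<omega>) = 0"
      proof (cases "int (length Zs) = p")
        case True
        then show ?thesis
          using complexify_weight[OF f *] len[OF *(3)]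
          by (simp add: complexify_diff complexify_cscale fun_eq_iff del: of_int_diff)
      next
        case nz: False
        have "int (length Zs + length Ws) = p + q" using * assms by simp
        then have "complexify (Zs @ Ws) \<omega> = 0"
          using O False nz * unfolding Omega_def by auto
        then show ?thesis
          using complexify_weight[OF f *] by (simp add: complexify_diff complexify_cscale fun_eq_iff)
      qed
    qed
    then show ?thesis using f by simp
  qed
qed

lemma Omega_negative: "p < 0 \<or> q < 0 \<Longrightarrow> Omega p q = {0}"
  by (simp add: Omega_def)

lemma Omega_forms: "\<omega> \<in> Omega p q \<Longrightarrow> \<omega> \<in> forms (nat (p + q))"
  by (auto simp: Omega_def zero_form split: if_splits)

lemma zero_Omega: "0 \<in> Omega p q"
  by (auto simp: Omega_def zero_form complexify_zero)

lemma diff_Omega: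
  assumes "\<omega> \<in> Omega p q" "\<eta> \<in> Omega p q"
  shows "\<omega> - \<eta> \<in> Omega p q"
proof (cases "p < 0 \<or> q < 0")
  case False
  then show ?thesis
    using assms by (simp add: Omega_iff_weight diff_form)
qed (use assms in \<open>simp add: Omega_negative\<close>)

text \<open>Eigenforms for the four different eigenvalues \<open>p - q + r\<close> with \<open>r = -3, -1, 1, 3\<close>.\<close>

lemma type_components_independent:
  assumes "a \<in> Omega (p - 1) (q + 2)" "b \<in> Omega p (q + 1)" "c \<in> Omega (p + 1) q" "e \<in> Omega (p + 2) (q - 1)"
    and sum: "a + b + c + e = 0"
  shows "a = 0 \<and> b = 0 \<and> c = 0 \<and> e = 0"
proof (cases "0 \<le> p + q + 1")
  case False
  then have "a = 0" "b = 0" "c = 0" "e = 0"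
    using assms Omega_negative by (auto split: if_splits simp: Omega_def)
  then show ?thesis by simp
next
  case True
  define w where "w \<omega> = weight \<omega> - cscale (of_int (p - q)) \<omega>" for \<omega>
  have w: "w a = cscale (- 3) a" "w b = cscale (- 1) b" "w c = cscale 1 c" "w e = cscale 3 e"
    using True assms
    by (auto simp: Omega_iff_weight w_def fscale_def fun_eq_iff algebra_simps)
  have lin: "w (\<omega> + \<eta>) = w \<omega> + w \<eta>" "w (cscale r \<omega>) = cscale r (w \<omega>)" "w 0 = 0" for \<omega> \<eta> r
    by (simp_all add: w_def algebra_simps)
  \<comment> \<open>Applying \<open>w\<close> repeatedly to the sum gives a Vandermonde system for the four components.\<close>
  have s1: "w (a + b + c + e) = 0" and s2: "w (w (a + b + c + e)) = 0" and s3: "w (w (w (a + b + c + e))) = 0"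
    unfolding sum by (simp_all only: lin)
  have "a Xs x = 0 \<and> b Xs x = 0 \<and> c Xs x = 0 \<and> e Xs x = 0" for Xs x
  proof -
    have "a Xs x + b Xs x + c Xs x + e Xs x = 0" using sum by (simp add: fun_eq_iff)
    moreover have "-3 * a Xs x - b Xs x + c Xs x + 3 * e Xs x = 0"
      using s1[unfolded lin w] by (simp add: fscale_def fun_eq_iff)
    moreover have "9 * a Xs x + b Xs x + c Xs x + 9 * e Xs x = 0"
      using s2[unfolded lin w] by (simp add: fscale_def fun_eq_iff)
    moreover have "-27 * a Xs x - b Xs x + c Xs x + 27 * e Xs x = 0"
      using s3[unfolded lin w] by (simp add: fscale_def fun_eq_iff)
    ultimately show ?thesis by algebra
  qed
  then show ?thesis by (simp add: fun_eq_iff)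
qed

lemma cscale_Omega:
  assumes "\<omega> \<in> Omega p q"
  shows "cscale c \<omega> \<in> Omega p q"
proof (cases "p < 0 \<or> q < 0")
  case False
  then show ?thesis
    using assms by (simp add: Omega_iff_weight cscale_form mult.commute)
qed (use assms in \<open>simp add: Omega_negative\<close>)

section \<open>Forms of type (p,0) and the exterior differential\<close>

text \<open>Contraction with the field of type \<open>(0,1)\<close> whose real part is \<open>X\<close>.\<close>

abbreviation contract01 :: "'a vfield \<Rightarrow> 'a form \<Rightarrow> 'a form" where
  "contract01 X \<equiv> icontract (X, jv X)"

lemma contract01_eq_0_iff:
  "contract01 X \<omega> = 0 \<longleftrightarrow> contract (jv X) \<omega> = cscale \<i> (contract X \<omega>)"
proof -
  have "a + \<i> * b = 0 \<longleftrightarrow> b = \<i> * a" for a b :: complex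
    by (auto simp: complex_eq_iff)
  then show ?thesis by (simp add: icontract_def fscale_def fun_eq_iff)
qed

lemma weight_of_p0:
  "\<omega> \<in> forms n \<Longrightarrow> (\<And>X. X \<in> vector_fields \<Longrightarrow> contract01 X \<omega> = 0) \<Longrightarrow> weight \<omega> = cscale (of_nat n) \<omega>"
proof (induction n arbitrary: \<omega>)
  case 0
  show ?case
    using form_0_contract[OF 0(1)] form_0_contract[OF weight_form[OF 0(1)]]
    by (intro form_eqI[OF weight_form[OF 0(1)] cscale_form[OF 0(1)]])
      (auto simp: weight_Nil fscale_apply fun_eq_iff)
next
  case (Suc n)
  note f = Suc.prems(1)
  have j: "contract (jv X) \<omega> = cscale \<i> (contract X \<omega>)" if "X \<in> vector_fields" for X
    using Suc.prems(2)[OF that] contract01_eq_0_iff by blast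
  show ?case
  proof (rule form_eqI[OF weight_form[OF f] cscale_form[OF f]])
    show "weight \<omega> [] = cscale (of_nat (Suc n)) \<omega> []"
      using forms_outside[OF f, of "[]"] by (simp add: weight_Nil fscale_apply fun_eq_iff)
    fix X assume X: "X \<in> vector_fields"
    have "weight (contract X \<omega>) = cscale (of_nat n) (contract X \<omega>)"
    proof (rule Suc.IH)
      show "contract X \<omega> \<in> forms n" using contract_form[OF f, of X] by simp
      show "contract01 Y (contract X \<omega>) = 0" if Y: "Y \<in> vector_fields" for Y
        unfolding contract01_eq_0_iff
        by (simp add: contract_swap[OF f J_smooth[OF Y] X] contract_swap[OF f Y X] j[OF Y])
    qed
    then show "contract X (weight \<omega>) = contract X (cscale (of_nat (Suc n)) \<omega>)"
      by (simp add: contract_weight[OF f X] j[OF X]) (simp add: fscale_def fun_eq_iff algebra_simps)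
  qed
qed

text \<open>Contraction with a \<open>(0,1)\<close>-field raises the weight by \<open>1\<close> and lowers the degree by \<open>1\<close>, and there are no
forms of degree \<open>n - 1\<close> with weight \<open>n + 1\<close>.\<close>

lemma Omega_p0_iff:
  "\<omega> \<in> Omega (int n) 0 \<longleftrightarrow> \<omega> \<in> forms n \<and> (\<forall>X\<in>vector_fields. contract01 X \<omega> = 0)"
proof (intro iffI conjI ballI)
  assume O: "\<omega> \<in> Omega (int n) 0"
  then show f: "\<omega> \<in> forms n" using Omega_forms by fastforce
  fix X assume X: "X \<in> vector_fields"
  show "contract01 X \<omega> = 0"
  proof (cases n)
    case 0
    then show ?thesis using f by (simp add: icontract_def form_0_contract)
  next
    case (Suc m)
    have "weight \<omega> = cscale (of_nat n) \<omega>" using O Omega_iff_weight[of "int n" 0] by simp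
    then have "contract01 X (weight \<omega>) = cscale (of_nat n) (contract01 X \<omega>)" by simp
    moreover have "contract01 X (weight \<omega>) = weight (contract01 X \<omega>) - contract01 X \<omega>"
      using icontract_weight_T01[OF f] X T01_iff by blast
    ultimately have "weight (contract01 X \<omega>) = cscale (of_nat n + 1) (contract01 X \<omega>)"
      by (simp add: fscale_def fun_eq_iff algebra_simps)
    moreover have "contract01 X \<omega> \<in> forms (nat (int n + -1))"
      using icontract_form[OF f] Suc by simp
    ultimately have "contract01 X \<omega> \<in> Omega (int n) (-1)"
      using Omega_iff_weight[of "int n" "-1"] Suc by simp
    then show ?thesis using Omega_negative by auto
  qed
next
  assume "\<omega> \<in> forms n \<and> (\<forall>X\<in>vector_fields. contract01 X \<omega> = 0)"
  then show "\<omega> \<in> Omega (int n) 0"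
    using weight_of_p0 Omega_iff_weight[of "int n" 0] by simp
qed

lemma contract_jv:
  "\<omega> \<in> Omega (int n) 0 \<Longrightarrow> X \<in> vector_fields \<Longrightarrow> contract (jv X) \<omega> = cscale \<i> (contract X \<omega>)"
  using Omega_p0_iff contract01_eq_0_iff by blast

text \<open>The forms without components of type \<open>(r,s)\<close> for \<open>s \<ge> m\<close>, expressed without reference to components so that
membership can be verified before a splitting is known to exist.\<close>

primrec filtration01 :: "nat \<Rightarrow> 'a form set" where
  "filtration01 0 = {0}"
| "filtration01 (Suc m) = {\<omega>. \<forall>X\<in>vector_fields. contract01 X \<omega> \<in> filtration01 m}"

lemma zero_filtration01: "0 \<in> filtration01 m"
  by (induction m) (simp_all del: zero_fun_apply)

lemma filtration01_1: "\<omega> \<in> forms n \<Longrightarrow> \<omega> \<in> filtration01 (Suc 0) \<longleftrightarrow> \<omega> \<in> Omega (int n) 0"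
  by (simp add: Omega_p0_iff)

text \<open>The number subtracted is the weight of the component of type \<open>(k - m, m)\<close>, the top one that a
form in the filtration may have; so this component is removed.\<close>

lemma weight_lowers_filtration01:
  "\<omega> \<in> forms k \<Longrightarrow> \<omega> \<in> filtration01 (Suc m) \<Longrightarrow> weight \<omega> - cscale (of_nat k - 2 * of_nat m) \<omega> \<in> filtration01 m"
proof (induction m arbitrary: \<omega> k)
  case 0
  then have "weight \<omega> = cscale (of_nat k) \<omega>" using weight_of_p0[of \<omega> k] by simp
  then show ?case by (simp del: zero_fun_apply)
next
  case (Suc m)
  have "contract01 X (weight \<omega> - cscale (of_nat k - 2 * of_nat (Suc m)) \<omega>) \<in> filtration01 m"
    if X: "X \<in> vector_fields" for X
  proof (cases k)
    case 0
    then show ?thesis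
      using Suc.prems(1) form_0_contract weight_form[OF Suc.prems(1)] zero_filtration01
      by (simp add: icontract_def)
  next
    case (Suc l)
    have "contract01 X \<omega> \<in> forms l" "contract01 X \<omega> \<in> filtration01 (Suc m)"
      using icontract_form[OF Suc.prems(1), of "(X, jv X)"] Suc Suc.prems(2) X by auto
    note IH = Suc.IH[OF this]
    have "contract01 X (weight \<omega>) = weight (contract01 X \<omega>) - contract01 X \<omega>"
      using icontract_weight_T01[OF Suc.prems(1)] X T01_iff by blast
    then have "contract01 X (weight \<omega> - cscale (of_nat k - 2 * of_nat (Suc m)) \<omega>)
        = weight (contract01 X \<omega>) - cscale (of_nat l - 2 * of_nat m) (contract01 X \<omega>)"
      by (simp add: Suc) (simp add: fscale_def fun_eq_iff algebra_simps)
    then show ?thesis using IH by (simp only:)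
  qed
  then show ?case unfolding filtration01.simps by blast
qed

text \<open>The removal of the component of type \<open>(n,1)\<close> multiplies the one of type \<open>(n + 1,0)\<close> by the difference \<open>2\<close> of
the weights, whence the formula for \<open>c\<close>.\<close>

lemma split_filtration01_2:
  assumes "\<omega> \<in> forms (Suc n)" "\<omega> \<in> filtration01 2"
  defines "c \<equiv> cscale (1/2) (weight \<omega> - cscale (of_nat n - 1) \<omega>)"
  shows "c \<in> Omega (int n + 1) 0 \<and> \<omega> - c \<in> Omega (int n) 1"
proof
  let ?\<beta> = "weight \<omega> - cscale (of_nat n - 1) \<omega>"
  have bf: "?\<beta> \<in> forms (Suc n)" by (intro diff_form cscale_form weight_form assms)
  have "weight \<omega> - cscale (of_nat (Suc n) - 2 * of_nat 1) \<omega> \<in> filtration01 1"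
    using assms(2) by (intro weight_lowers_filtration01[OF assms(1)]) (simp add: numeral_2_eq_2)
  then have b: "?\<beta> \<in> Omega (int n + 1) 0"
    using filtration01_1[OF bf] by (simp add: algebra_simps)
  then show c: "c \<in> Omega (int n + 1) 0" unfolding c_def by (rule cscale_Omega)
  have "weight c = cscale (of_nat n + 1) c" using c Omega_iff_weight[of "int n + 1" 0] by simp
  moreover have "weight \<omega> = cscale 2 c + cscale (of_nat n - 1) \<omega>"
    by (simp add: c_def fscale_def fun_eq_iff field_simps)
  ultimately have "weight (\<omega> - c) = cscale (of_nat n - 1) (\<omega> - c)"
    by simp (simp add: fscale_def fun_eq_iff algebra_simps)
  moreover have "\<omega> - c \<in> forms (Suc n)"
    unfolding c_def by (intro diff_form cscale_form weight_form assms)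
  ultimately show "\<omega> - c \<in> Omega (int n) 1"
    using Omega_iff_weight[of "int n" 1] by (simp add: nat_add_distrib)
qed

text \<open>The component of type \<open>(n - 1,2)\<close> is removed first. In what remains, the components of types \<open>(n,1)\<close> and
\<open>(n + 1,0)\<close> are multiplied by the differences \<open>2\<close> and \<open>4\<close> of the weights.\<close>

lemma split_filtration01_3:
  assumes "\<omega> \<in> forms (Suc n)" "\<omega> \<in> filtration01 3"
  shows "\<exists>a\<in>Omega (int n - 1) 2. \<exists>b\<in>Omega (int n) 1. \<exists>c\<in>Omega (int n + 1) 0. \<omega> = a + b + c"
proof -
  let ?\<beta> = "weight \<omega> - cscale (of_nat n - 3) \<omega>"
  have bf: "?\<beta> \<in> forms (Suc n)" by (intro diff_form cscale_form weight_form assms)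
  have "weight \<omega> - cscale (of_nat (Suc n) - 2 * of_nat 2) \<omega> \<in> filtration01 2"
    using assms(2) by (intro weight_lowers_filtration01[OF assms(1)]) (simp add: numeral_3_eq_3 numeral_2_eq_2)
  then have "?\<beta> \<in> filtration01 2" by (simp add: algebra_simps)
  from split_filtration01_2[OF bf this] obtain b c where c: "c \<in> Omega (int n + 1) 0" and b: "b \<in> Omega (int n) 1"
    and bc: "?\<beta> = b + c" by force
  have wc: "weight c = cscale (of_nat n + 1) c" using c Omega_iff_weight[of "int n + 1" 0] by simp
  have wb: "weight b = cscale (of_nat n - 1) b" using b Omega_iff_weight[of "int n" 1] by simp
  have ww: "weight \<omega> = b + c + cscale (of_nat n - 3) \<omega>" using bc by (simp add: algebra_simps)
  define a where "a = \<omega> - cscale (1/2) b - cscale (1/4) c"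
  have "weight a = cscale (of_nat n - 3) a"
    by (simp add: a_def wb wc ww) (simp add: fscale_def fun_eq_iff field_simps)
  moreover have "a \<in> forms (Suc n)"
    unfolding a_def using Omega_forms[OF b] Omega_forms[OF c]
    by (intro diff_form cscale_form assms) (simp_all add: nat_add_distrib)
  ultimately have "a \<in> Omega (int n - 1) 2"
    using Omega_iff_weight[of "int n - 1" 2] by (simp add: nat_add_distrib)
  moreover have "\<omega> = a + cscale (1/2) b + cscale (1/4) c" by (simp add: a_def)
  ultimately show ?thesis using cscale_Omega[OF b] cscale_Omega[OF c] by blast
qed

text \<open>The contractions of \<open>d\<omega>\<close> reduce to \<open>- \<iota>\<^bsub>[Z,W]\<^esub> \<omega>\<close> for the two \<open>(0,1)\<close>-fields \<open>Z\<close> and \<open>W\<close>, because both annihilate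
\<open>\<omega>\<close>; and modulo \<open>(0,1)\<close>-fields, \<open>- [Z,W]\<close> is a value of the Nijenhuis tensor.\<close>

lemma contract01_contract01_ext_d:
  assumes O: "\<omega> \<in> Omega (int n) 0" and X: "X \<in> vector_fields" and Y: "Y \<in> vector_fields"
  shows "contract01 Y (contract01 X (ext_d \<omega>)) = contract (nijenhuis X Y) \<omega>"
proof -
  have f: "\<omega> \<in> forms n" using O Omega_p0_iff by blast
  note jX = J_smooth[OF X] and jY = J_smooth[OF Y]
  note cj = contract_jv[OF O]
  note cf = contract_form[OF f]
  have "contract01 X (ext_d \<omega>) = lie_form X \<omega> + cscale \<i> (lie_form (jv X) \<omega>)"
    by (simp add: icontract_def cartan_formula[OF f] X jX cj ext_d_cscale[OF cf])
  then have *: "contract01 Y (contract01 X (ext_d \<omega>)) = - contract (bracket X Y) \<omega>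
      - cscale \<i> (contract (bracket (jv X) Y) \<omega>) - cscale \<i> (contract (bracket X (jv Y)) \<omega>)
      + contract (bracket (jv X) (jv Y)) \<omega>"
    by (simp add: icontract_def[of "(Y, jv Y)"] contract_lie_form[OF f] Y jY cj lie_form_cscale[OF _ cf] X jX)
  show ?thesis
    unfolding * nijenhuis_def
    by (simp add: contract_diff_left[OF f] jv_intros X Y cj)
qed

text \<open>Two contractions of \<open>d\<omega>\<close> lead back to a contraction of \<open>\<omega>\<close>, which the third one annihilates.\<close>

lemma ext_d_in_filtration01_3:
  assumes "\<omega> \<in> Omega (int n) 0"
  shows "ext_d \<omega> \<in> filtration01 3"
proof -
  have f: "\<omega> \<in> forms n" using assms Omega_p0_iff by blast
  have "contract01 Z (contract (nijenhuis X Y) \<omega>) = 0"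
    if "X \<in> vector_fields" "Y \<in> vector_fields" "Z \<in> vector_fields" for X Y Z
  proof -
    have N: "nijenhuis X Y \<in> vector_fields" unfolding nijenhuis_def by (intro jv_intros that)
    show ?thesis
      using that
      by (simp add: contract01_eq_0_iff contract_swap[OF f _ N] jv_intros contract_jv[OF assms])
  qed
  then show ?thesis
    by (simp add: numeral_3_eq_3 contract01_contract01_ext_d[OF assms])
qed

section \<open>The limit distribution\<close>

lemma fspan_fields:
  assumes "R \<subseteq> smooth_fun" "S \<subseteq> vector_fields" "X \<in> fspan R S"
  shows "X \<in> vector_fields"
  using assms(3)
proof induction
  case fspan_zero
  show ?case by (rule vf_zero_closed)
next
  case (fspan_step f X Y)
  then show ?case using assms by (intro vf_add_closed vf_fmult_closed) auto
qed

lemma fspan_generator: "(\<lambda>x. 1) \<in> R \<Longrightarrow> X \<in> S \<Longrightarrow> X \<in> fspan R S"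
  using fspan.fspan_step[OF _ _ fspan.fspan_zero, of "\<lambda>x. 1" R X S] by (simp add: fmult_const_one)

lemma fspan_add: "X \<in> fspan R S \<Longrightarrow> Y \<in> fspan R S \<Longrightarrow> X + Y \<in> fspan R S"
  by (induction rule: fspan.induct) (auto simp: add.assoc intro: fspan.fspan_step)

lemma fspan_jv:
  assumes "R \<subseteq> smooth_fun" "S \<subseteq> vector_fields" "\<And>X. X \<in> S \<Longrightarrow> jv X \<in> S" "X \<in> fspan R S"
  shows "jv X \<in> fspan R S"
  using assms(4)
proof induction
  case fspan_zero
  show ?case unfolding jv_zero by (rule fspan.fspan_zero)
next
  case (fspan_step f X Y)
  have "X \<in> vector_fields" "Y \<in> vector_fields" "fmult f X \<in> vector_fields"
    using fspan_step assms fspan_fields[OF assms(1,2)] by (auto intro: vf_fmult_closed)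
  then have "jv (fmult f X + Y) = fmult f (jv X) + jv Y" by (simp add: jv_add jv_fmult)
  then show ?case using fspan.fspan_step[of f R "jv X" S "jv Y"] fspan_step assms(3) by (simp only:)
qed

lemma range_const_smooth: "range (\<lambda>c x. c) \<subseteq> smooth_fun"
  using smooth_fun_const by auto

lemma nijenhuis_fields: "X \<in> vector_fields \<Longrightarrow> Y \<in> vector_fields \<Longrightarrow> nijenhuis X Y \<in> vector_fields"
  unfolding nijenhuis_def by (intro jv_intros)

lemma lie_j_fields: "U \<in> vector_fields \<Longrightarrow> X \<in> vector_fields \<Longrightarrow> lie_j U X \<in> vector_fields"
  unfolding lie_j_def by (intro jv_intros)

lemma jv_nijenhuis:
  assumes "X \<in> vector_fields" "Y \<in> vector_fields"
  shows "jv (nijenhuis X Y) = nijenhuis (- jv X) Y"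
  using assms
  by (simp add: nijenhuis_def jv_minus jv_diff jv_jv jv_intros bracket_minus_left)

lemma jv_lie_j:
  assumes "U \<in> vector_fields" "X \<in> vector_fields"
  shows "jv (lie_j U X) = lie_j U (- jv X)"
  using assms
  by (simp add: lie_j_def jv_minus jv_diff jv_jv jv_intros bracket_minus_right)

lemma lspan_add: "X \<in> lspan S \<Longrightarrow> Y \<in> lspan S \<Longrightarrow> X + Y \<in> lspan S"
  unfolding lspan_def by (rule fspan_add)

lemma lspan_zero: "0 \<in> lspan S"
  unfolding lspan_def by (rule fspan.fspan_zero)

lemma lspan_generator: "X \<in> S \<Longrightarrow> X \<in> lspan S"
  unfolding lspan_def by (rule fspan_generator) auto

lemma D_dist_Suc_iff:
  "X \<in> D_dist (Suc k) \<longleftrightarrow> (\<exists>A\<in>D_dist k. \<exists>B\<in>lspan (\<Union>U\<in>D_dist k. lie_j U ` vector_fields).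
     \<exists>C\<in>lspan {bracket U V | U V. U \<in> D_dist k \<and> V \<in> D_dist k}. X = A + B + C)"
  by (simp add: set_plus_def) blast

lemma nijenhuis_in_D_dist: "X \<in> vector_fields \<Longrightarrow> Y \<in> vector_fields \<Longrightarrow> nijenhuis X Y \<in> D_dist 0"
  using smooth_fun_const by (auto intro!: fspan_generator)

lemma D_dist_zero: "0 \<in> D_dist k"
proof (induction k)
  case 0
  show ?case unfolding D_dist.simps by (rule fspan.fspan_zero)
next
  case (Suc k)
  have "0 = (0 :: 'a vfield) + 0 + 0" by simp
  then show ?case unfolding D_dist_Suc_iff using Suc lspan_zero by blast
qed

lemma lie_j_in_D_dist:
  assumes "U \<in> D_dist k" "X \<in> vector_fields"
  shows "lie_j U X \<in> D_dist (Suc k)"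
proof -
  have "lie_j U X = 0 + lie_j U X + 0" by simp
  moreover have "lie_j U X \<in> lspan (\<Union>U\<in>D_dist k. lie_j U ` vector_fields)"
    using assms by (intro lspan_generator) auto
  ultimately show ?thesis unfolding D_dist_Suc_iff using D_dist_zero lspan_zero by blast
qed

lemma D_dist_fields: "D_dist k \<subseteq> vector_fields"
proof (induction k)
  case 0
  have "{nijenhuis X Y |X Y. X \<in> vector_fields \<and> Y \<in> vector_fields} \<subseteq> vector_fields"
    using nijenhuis_fields by blast
  from fspan_fields[OF subset_refl this] show ?case unfolding D_dist.simps by (rule subsetI)
next
  case (Suc k)
  let ?L = "\<Union>U\<in>D_dist k. lie_j U ` vector_fields"
  let ?B = "{bracket U V | U V. U \<in> D_dist k \<and> V \<in> D_dist k}"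
  have "?L \<subseteq> vector_fields" "?B \<subseteq> vector_fields"
    using Suc by (auto intro: lie_j_fields bracket_closed)
  note lspan_fields = this[THEN fspan_fields[OF range_const_smooth], folded lspan_def]
  show ?case
  proof
    fix X assume "X \<in> D_dist (Suc k)"
    then obtain A B C where ABC: "A \<in> D_dist k" "B \<in> lspan ?L" "C \<in> lspan ?B" "X = A + B + C"
      unfolding D_dist_Suc_iff by blast
    show "X \<in> vector_fields"
      unfolding ABC(4) by (intro vf_add_closed lspan_fields ABC subsetD[OF Suc ABC(1)])
  qed
qed

text \<open>Values of the Nijenhuis tensor and of \<open>lie_j U\<close> are mapped to such values, because both tensors are
\<open>j\<close>-antilinear. A bracket is mapped to a bracket only up to a value of \<open>lie_j U\<close>, which belongs to
the same step of the sequence.\<close>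

lemma D_dist_jv: "X \<in> D_dist k \<Longrightarrow> jv X \<in> D_dist k"
proof (induction k arbitrary: X)
  case 0
  let ?S = "{nijenhuis X Y |X Y. X \<in> vector_fields \<and> Y \<in> vector_fields}"
  have "jv Z \<in> ?S" if "Z \<in> ?S" for Z
  proof -
    from that obtain X Y where "X \<in> vector_fields" "Y \<in> vector_fields" "Z = nijenhuis X Y" by auto
    moreover from this have "- jv X \<in> vector_fields" by (intro jv_intros)
    ultimately show ?thesis using jv_nijenhuis[of X Y] by blast
  qed
  then have "jv X \<in> fspan smooth_fun ?S"
    using 0 nijenhuis_fields by (intro fspan_jv) auto
  then show ?case by simp
next
  case (Suc k)
  let ?L = "\<Union>U\<in>D_dist k. lie_j U ` vector_fields"
  let ?B = "{bracket U V | U V. U \<in> D_dist k \<and> V \<in> D_dist k}"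
  note D = subsetD[OF D_dist_fields]
  have Lf: "?L \<subseteq> vector_fields" and Bf: "?B \<subseteq> vector_fields"
    using D by (auto intro: lie_j_fields bracket_closed)
  have jL: "jv Z \<in> lspan ?L" if "Z \<in> lspan ?L" for Z
  proof -
    have "jv W \<in> ?L" if "W \<in> ?L" for W
    proof -
      from that obtain U X where U: "U \<in> D_dist k" "X \<in> vector_fields" "W = lie_j U X" by auto
      then have "jv W = lie_j U (- jv X)" using jv_lie_j D by blast
      moreover have "- jv X \<in> vector_fields" using U by (intro jv_intros)
      ultimately show ?thesis using U by blast
    qed
    then show ?thesis using that unfolding lspan_def by (intro fspan_jv[OF range_const_smooth Lf])
  qed
  have jB: "\<exists>P\<in>lspan ?L. \<exists>Q\<in>lspan ?B. jv Z = P + Q" if "Z \<in> lspan ?B" for Z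
    using that unfolding lspan_def
  proof induction
    case fspan_zero
    have "jv 0 = 0 + 0" by (simp add: jv_zero)
    then show ?case using fspan.fspan_zero by blast
  next
    case (fspan_step f X Y)
    then obtain P Q where PQ: "P \<in> lspan ?L" "Q \<in> lspan ?B" "jv Y = P + Q" unfolding lspan_def by blast
    obtain U V where UV: "U \<in> D_dist k" "V \<in> D_dist k" "X = bracket U V" using fspan_step by blast
    have X: "X \<in> vector_fields" and Y: "Y \<in> vector_fields"
      using fspan_step fspan_fields[OF range_const_smooth Bf] Bf by blast+
    have f: "f \<in> range (\<lambda>c x. c)" "f \<in> smooth_fun" using fspan_step range_const_smooth by auto
    have mf: "(\<lambda>x. - f x) \<in> range (\<lambda>c x. c)" using f by auto
    \<comment> \<open>\<open>j\<close> is moved inside the bracket at the cost of a value of \<open>lie_j U\<close>.\<close>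
    have "jv X = bracket U (jv V) - lie_j U V" using UV by (simp add: lie_j_def)
    then have "jv (fmult f X + Y) = (fmult (\<lambda>x. - f x) (lie_j U V) + P) + (fmult f (bracket U (jv V)) + Q)"
      using X Y f PQ by (simp add: jv_add jv_fmult vf_fmult_closed) (simp add: fmult_def fun_eq_iff algebra_simps)
    moreover have "fmult (\<lambda>x. - f x) (lie_j U V) + P \<in> lspan ?L"
      using PQ mf UV D unfolding lspan_def by (intro fspan.fspan_step) auto
    moreover have "fmult f (bracket U (jv V)) + Q \<in> lspan ?B"
      using PQ f UV Suc.IH unfolding lspan_def by (intro fspan.fspan_step) auto
    ultimately show ?case unfolding lspan_def by blast
  qed
  obtain A B C where ABC: "A \<in> D_dist k" "B \<in> lspan ?L" "C \<in> lspan ?B" "X = A + B + C"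
    using Suc.prems unfolding D_dist_Suc_iff by blast
  obtain P Q where PQ: "P \<in> lspan ?L" "Q \<in> lspan ?B" "jv C = P + Q" using jB ABC by blast
  have "A \<in> vector_fields" "B \<in> vector_fields" "C \<in> vector_fields"
    using ABC D fspan_fields[OF range_const_smooth Lf] fspan_fields[OF range_const_smooth Bf] unfolding lspan_def by blast+
  then have "jv X = jv A + (jv B + P) + Q"
    by (simp add: ABC(4) jv_add vf_add_closed PQ(3) add.assoc)
  then show ?case
    unfolding D_dist_Suc_iff using Suc.IH[OF ABC(1)] lspan_add[OF jL[OF ABC(2)] PQ(1)] PQ(2) by blast
qed

lemma D_inf_fields: "D_inf \<subseteq> vector_fields"
  unfolding D_inf_def using D_dist_fields by blast

lemma D_inf_jv: "X \<in> D_inf \<Longrightarrow> jv X \<in> D_inf"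
  unfolding D_inf_def using D_dist_jv by blast

lemma lie_j_in_D_inf: "U \<in> D_inf \<Longrightarrow> X \<in> vector_fields \<Longrightarrow> lie_j U X \<in> D_inf"
  unfolding D_inf_def using lie_j_in_D_dist by blast

section \<open>Annihilation by the limit distribution\<close>

text \<open>The commutator of \<open>lie_form U\<close> with the extension of \<open>j\<close> to forms is the extension of \<open>lie_j U\<close>.\<close>

lemma lie_form_weight:
  assumes U: "U \<in> vector_fields" and "\<omega> \<in> forms k"
    and "\<And>Y. Y \<in> vector_fields \<Longrightarrow> contract (lie_j U Y) \<omega> = 0"
  shows "lie_form U (weight \<omega>) = weight (lie_form U \<omega>)"
proof (rule form_operator_eqI[where C = "{\<omega>. (\<exists>k. \<omega> \<in> forms k) \<and> (\<forall>Y\<in>vector_fields. contract (lie_j U Y) \<omega> = 0)}"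
      and A = "\<lambda>\<omega>. lie_form U (weight \<omega>)" and B = "\<lambda>\<omega>. weight (lie_form U \<omega>)"])
  fix \<omega> :: "'a form" and Y and Xs :: "'a vfield list"
  let ?C = "{\<omega>. (\<exists>k. \<omega> \<in> forms k) \<and> (\<forall>Y\<in>vector_fields. contract (lie_j U Y) \<omega> = 0)}"
  assume C: "\<omega> \<in> ?C" and Y: "Y \<in> vector_fields"
    and IH: "\<And>\<eta>. \<eta> \<in> ?C \<Longrightarrow> lie_form U (weight \<eta>) Xs = weight (lie_form U \<eta>) Xs"
  from C obtain k where f: "\<omega> \<in> forms k" by auto
  note cf = contract_form[OF f] and jY = J_smooth[OF Y] and UY = bracket_closed[OF U Y]
  have "contract (lie_j U Z) (contract Y \<omega>) = 0" if "Z \<in> vector_fields" for Z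
    using C that contract_swap[OF f lie_j_fields[OF U that] Y] by simp
  then have "contract Y \<omega> \<in> ?C" using cf by blast
  note IH' = IH[OF this]
  have lj: "contract (bracket U (jv Y)) \<omega> = contract (jv (bracket U Y)) \<omega>"
  proof -
    have "contract (lie_j U Y) \<omega> = 0" using C Y by simp
    then show ?thesis
      unfolding lie_j_def by (simp add: contract_diff_left[OF f] U Y jY jv_intros)
  qed
  have "contract Y (lie_form U (weight \<omega>)) = lie_form U (weight (contract Y \<omega>))
      - cscale \<i> (lie_form U (contract (jv Y) \<omega>))
      - (weight (contract (bracket U Y) \<omega>) - cscale \<i> (contract (jv (bracket U Y)) \<omega>))"
    by (simp add: contract_lie_form[OF weight_form[OF f] Y] contract_weight[OF f] Y UY
        lie_form_diff[OF U weight_form[OF cf] cscale_form[OF cf]] lie_form_cscale[OF U cf])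
  moreover have "contract Y (weight (lie_form U \<omega>)) = weight (lie_form U (contract Y \<omega>))
      - weight (contract (bracket U Y) \<omega>)
      - cscale \<i> (lie_form U (contract (jv Y) \<omega>) - contract (bracket U (jv Y)) \<omega>)"
    by (simp add: contract_weight[OF lie_form_form[OF U f] Y] contract_lie_form[OF f] Y jY)
  ultimately show "contract Y (lie_form U (weight \<omega>)) Xs = contract Y (weight (lie_form U \<omega>)) Xs"
    using IH' lj by simp
qed (use assms in \<open>auto simp: lie_form_Nil weight_Nil vact_const zero_fun_def lie_form_outside
        weight_outside fun_eq_iff\<close>)

lemma contract_fspan_eq_0:
  assumes "\<omega> \<in> forms n" "R \<subseteq> smooth_fun" "S \<subseteq> vector_fields" "\<And>X. X \<in> S \<Longrightarrow> contract X \<omega> = 0"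
    and "X \<in> fspan R S"
  shows "contract X \<omega> = 0"
  using assms(5)
proof induction
  case fspan_zero
  show ?case by (rule contract_zero_left[OF assms(1)])
next
  case (fspan_step f X Y)
  then have "f \<in> smooth_fun" "X \<in> vector_fields" "Y \<in> vector_fields"
    using fspan_fields[OF assms(2,3)] assms by auto
  then show ?case
    unfolding contract_linear[OF assms(1) \<open>f \<in> smooth_fun\<close> \<open>X \<in> vector_fields\<close> \<open>Y \<in> vector_fields\<close>]
    by (simp add: fspan_step.IH assms(4)[OF fspan_step.hyps(2)])
qed

text \<open>The induction has to run over all degrees \<open>n\<close> simultaneously: the step for \<open>\<omega>\<close> uses the hypothesis for
\<open>ext_d \<omega>\<close>, in order to get \<open>lie_form U \<omega> = 0\<close>.\<close>

lemma contract_D_dist_eq_0: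
  assumes "\<omega> \<in> Omega (int n) 0" "ext_d \<omega> \<in> Omega (int n + 1) 0" "X \<in> D_dist k"
  shows "contract X \<omega> = 0"
  using assms
proof (induction k arbitrary: n \<omega> X)
  case 0
  have f: "\<omega> \<in> forms n" and d: "ext_d \<omega> \<in> Omega (int (Suc n)) 0"
    using 0 Omega_p0_iff by (auto simp: add.commute)
  have "contract (nijenhuis Y Z) \<omega> = 0" if YZ: "Y \<in> vector_fields" "Z \<in> vector_fields" for Y Z
  proof -
    have "contract01 Y (ext_d \<omega>) = 0" using d YZ Omega_p0_iff by blast
    then show ?thesis by (simp flip: contract01_contract01_ext_d[OF 0(1) YZ])
  qed
  then show ?case
    using 0(3) nijenhuis_fields unfolding D_dist.simps
    by (elim contract_fspan_eq_0[OF f subset_refl, rotated -1]) auto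
next
  case (Suc k)
  note O = Suc.prems(1)
  have f: "\<omega> \<in> forms n" and d: "ext_d \<omega> \<in> Omega (int (Suc n)) 0"
    using Suc.prems Omega_p0_iff by (auto simp: add.commute)
  have dd: "ext_d (ext_d \<omega>) \<in> Omega (int (Suc n) + 1) 0"
    unfolding ext_d_ext_d[OF f] by (rule zero_Omega)
  note cf = contract_form[OF f]
  note D = subsetD[OF D_dist_fields]
  have c: "contract U \<omega> = 0" and l: "lie_form U \<omega> = 0" if U: "U \<in> D_dist k" for U
  proof -
    show c: "contract U \<omega> = 0" by (rule Suc.IH[OF Suc.prems(1,2) U])
    have "contract U (ext_d \<omega>) = 0" by (rule Suc.IH[OF d dd U])
    with cartan_formula[OF f D[OF U]] c show "lie_form U \<omega> = 0" by (simp add: ext_d_zero)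
  qed
  \<comment> \<open>Both \<open>[U, jY]\<close> and \<open>j [U, Y]\<close> contract \<open>\<omega>\<close> to \<open>\<i> L\<^sub>U \<iota>\<^sub>Y \<omega>\<close>, since \<open>L\<^sub>U \<omega> = 0\<close>.\<close>
  have lj: "contract (lie_j U Y) \<omega> = 0" if U: "U \<in> D_dist k" and Y: "Y \<in> vector_fields" for U Y
  proof -
    note Uf = D[OF U] and jY = J_smooth[OF Y]
    have "contract (bracket U Z) \<omega> = lie_form U (contract Z \<omega>)" if "Z \<in> vector_fields" for Z
      using contract_lie_form[OF f that, of U] by (simp add: l[OF U])
    then show ?thesis
      unfolding lie_j_def
      by (simp add: contract_diff_left[OF f] jv_intros Uf Y contract_jv[OF O] lie_form_cscale[OF Uf cf])
  qed
  have br: "contract (bracket U V) \<omega> = 0" if "U \<in> D_dist k" "V \<in> D_dist k" for U V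
    using contract_lie_form[OF f D[OF that(2)], of U]
    by (simp add: l[OF that(1)] c[OF that(2)] lie_form_zero[OF D[OF that(1)]])
  let ?L = "\<Union>U\<in>D_dist k. lie_j U ` vector_fields"
  let ?B = "{bracket U V | U V. U \<in> D_dist k \<and> V \<in> D_dist k}"
  have Lf: "?L \<subseteq> vector_fields" and Bf: "?B \<subseteq> vector_fields"
    using D by (auto intro: lie_j_fields bracket_closed)
  obtain A B C where ABC: "A \<in> D_dist k" "B \<in> lspan ?L" "C \<in> lspan ?B" "X = A + B + C"
    using Suc.prems unfolding D_dist_Suc_iff by blast
  have v: "A \<in> vector_fields" "B \<in> vector_fields" "C \<in> vector_fields"
    using ABC D fspan_fields[OF range_const_smooth Lf] fspan_fields[OF range_const_smooth Bf] unfolding lspan_def by blast+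
  have "contract B \<omega> = 0"
    using ABC(2) unfolding lspan_def by (rule contract_fspan_eq_0[OF f range_const_smooth Lf, rotated]) (use lj in auto)
  moreover have "contract C \<omega> = 0"
    using ABC(3) unfolding lspan_def by (rule contract_fspan_eq_0[OF f range_const_smooth Bf, rotated]) (use br in auto)
  ultimately show ?case
    unfolding ABC(4) contract_add_left[OF f vf_add_closed[OF v(1,2)] v(3)] contract_add_left[OF f v(1,2)]
    by (simp add: c[OF ABC(1)])
qed

lemma Omega_trans_if_ext_d_holomorphic:
  assumes "\<omega> \<in> Omega (int n) 0" "ext_d \<omega> \<in> Omega (int n + 1) 0"
  shows "\<omega> \<in> Omega_trans (int n) 0"
proof -
  have f: "\<omega> \<in> forms n" and d: "ext_d \<omega> \<in> Omega (int (Suc n)) 0"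
    using assms Omega_p0_iff by (auto simp: add.commute)
  have dd: "ext_d (ext_d \<omega>) \<in> Omega (int (Suc n) + 1) 0"
    unfolding ext_d_ext_d[OF f] by (rule zero_Omega)
  have "contract X \<omega> = 0 \<and> lie_form X \<omega> = 0" if X: "X \<in> D_inf" for X
  proof -
    obtain k where k: "X \<in> D_dist k" using X unfolding D_inf_def by blast
    have c: "contract X \<omega> = 0" by (rule contract_D_dist_eq_0[OF assms k])
    have "contract X (ext_d \<omega>) = 0" by (rule contract_D_dist_eq_0[OF d dd k])
    with cartan_formula[OF f, of X] c D_inf_fields X show ?thesis by (auto simp: ext_d_zero)
  qed
  then show ?thesis using assms by (simp add: Omega_trans_def)
qed

text \<open>The \<open>(n - 1,2)\<close>-component of \<open>ext_d \<omega>\<close> is determined by the contractions of \<open>\<omega>\<close> with values of the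
Nijenhuis tensor, so it is zero. The other components are polynomials in \<open>weight\<close> applied to \<open>ext_d \<omega>\<close>, and \<open>weight\<close>
preserves transversality.\<close>

lemma ext_d_splits_transversally:
  assumes "\<omega> \<in> Omega_trans (int n) 0"
  shows "\<exists>b\<in>Omega_trans (int n) 1. \<exists>c\<in>Omega_trans (int n + 1) 0. ext_d \<omega> = b + c"
proof -
  note Df = subsetD[OF D_inf_fields]
  have O: "\<omega> \<in> Omega (int n) 0" and t: "\<And>U. U \<in> D_inf \<Longrightarrow> contract U \<omega> = 0" "\<And>U. U \<in> D_inf \<Longrightarrow> lie_form U \<omega> = 0"
    using assms by (auto simp: Omega_trans_def)
  have f: "\<omega> \<in> forms n" using O Omega_p0_iff by blast
  note df = ext_d_form[OF f]
  have "nijenhuis X Y \<in> D_inf" if "X \<in> vector_fields" "Y \<in> vector_fields" for X Y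
    using nijenhuis_in_D_dist[OF that] unfolding D_inf_def by blast
  then have F: "ext_d \<omega> \<in> filtration01 2"
    by (simp add: numeral_2_eq_2 contract01_contract01_ext_d[OF O] t(1))
  define c where "c = cscale (1/2) (weight (ext_d \<omega>) - cscale (of_nat n - 1) (ext_d \<omega>))"
  have split: "c \<in> Omega (int n + 1) 0" "ext_d \<omega> - c \<in> Omega (int n) 1"
    using split_filtration01_2[OF df F] unfolding c_def by blast+
  have cf: "c \<in> forms (Suc n)"
    unfolding c_def by (intro cscale_form diff_form weight_form df)
  have tc: "contract U (ext_d \<omega>) = 0 \<and> lie_form U (ext_d \<omega>) = 0 \<and> contract U c = 0 \<and> lie_form U c = 0"
    if U: "U \<in> D_inf" for U
  proof -
    have d0: "contract V (ext_d \<omega>) = 0" if "V \<in> D_inf" for V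
      using cartan_formula[OF f Df[OF that]] t[OF that] by (simp add: ext_d_zero)
    have l0: "lie_form U (ext_d \<omega>) = 0"
      using lie_form_ext_d[OF Df[OF U] f] t[OF U] by (simp add: ext_d_zero)
    have "contract U c = 0"
      unfolding c_def by (simp add: contract_weight[OF df Df[OF U]] d0 U D_inf_jv)
    moreover have "lie_form U (weight (ext_d \<omega>)) = 0"
      using lie_form_weight[OF Df[OF U] df] d0 lie_j_in_D_inf[OF U] l0 by simp
    then have "lie_form U c = 0"
      unfolding c_def lie_form_cscale[OF Df[OF U] diff_form[OF weight_form[OF df] cscale_form[OF df]]]
        lie_form_diff[OF Df[OF U] weight_form[OF df] cscale_form[OF df]] lie_form_cscale[OF Df[OF U] df] l0
      by simp
    ultimately show ?thesis using d0[OF U] l0 by blast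
  qed
  have "c \<in> Omega_trans (int n + 1) 0" using split tc by (simp add: Omega_trans_def)
  moreover have "ext_d \<omega> - c \<in> Omega_trans (int n) 1"
    using split tc lie_form_diff[OF Df df cf] by (simp add: Omega_trans_def)
  moreover have "ext_d \<omega> = (ext_d \<omega> - c) + c" by simp
  ultimately show ?thesis by blast
qed

section \<open>Cohomology in degree (p,0)\<close>

lemma d_splits_unique:
  assumes "d_splits p q \<omega> a b c e" "d_splits p q \<omega> a' b' c' e'"
  shows "a = a' \<and> b = b' \<and> c = c' \<and> e = e'"
proof -
  have "a - a' = 0 \<and> b - b' = 0 \<and> c - c' = 0 \<and> e - e' = 0"
  proof (rule type_components_independent)
    have "a + b + c + e = a' + b' + c' + e'" using assms by (simp add: d_splits_def)
    then show "(a - a') + (b - b') + (c - c') + (e - e') = 0" by (simp add: algebra_simps)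
  qed (use assms in \<open>auto simp: d_splits_def intro: diff_Omega\<close>)
  then show ?thesis by simp
qed

lemma mubar_eq: "d_splits p q \<omega> a b c e \<Longrightarrow> mubar p q \<omega> = a"
  unfolding mubar_def using d_splits_unique by (intro the_equality) blast+

lemma delbar_eq: "d_splits p q \<omega> a b c e \<Longrightarrow> delbar p q \<omega> = b"
  unfolding delbar_def using d_splits_unique by (intro the_equality) blast+

lemma d_splits_zero: "d_splits p q 0 0 0 0 0"
  unfolding d_splits_def by (simp add: zero_Omega ext_d_zero)

lemmas mubar_zero = mubar_eq[OF d_splits_zero] and delbar_zero = delbar_eq[OF d_splits_zero]

lemma zero_Omega_trans: "0 \<in> Omega_trans p q"
  unfolding Omega_trans_def using D_inf_fields by (auto simp: zero_Omega lie_form_zero)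

lemma delbar_trans_eq:
  assumes "b \<in> Omega_trans p (q + 1)" "c \<in> Omega_trans (p + 1) q" "ext_d \<omega> = b + c"
  shows "delbar_trans p q \<omega> = b"
  unfolding delbar_trans_def
proof (rule the_equality)
  fix b' assume "b' \<in> Omega_trans p (q + 1) \<and> (\<exists>c\<in>Omega_trans (p + 1) q. ext_d \<omega> = b' + c)"
  then obtain c' where "b' \<in> Omega_trans p (q + 1)" "c' \<in> Omega_trans (p + 1) q" "ext_d \<omega> = b' + c'" by blast
  then have "d_splits p q \<omega> 0 b c 0" "d_splits p q \<omega> 0 b' c' 0"
    using assms by (auto simp: d_splits_def zero_Omega Omega_trans_def)
  then show "b' = b" using d_splits_unique by blast
qed (use assms in blast)

lemma delbar_trans_zero: "delbar_trans p q 0 = 0"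
  by (rule delbar_trans_eq[OF zero_Omega_trans zero_Omega_trans]) (simp add: ext_d_zero)

lemma mubar_delbar_eq_0_iff:
  assumes "\<omega> \<in> Omega (int n) 0"
  shows "mubar (int n) 0 \<omega> = 0 \<and> delbar (int n) 0 \<omega> = 0 \<longleftrightarrow> ext_d \<omega> \<in> Omega (int n + 1) 0"
proof
  assume "ext_d \<omega> \<in> Omega (int n + 1) 0"
  then have "d_splits (int n) 0 \<omega> 0 0 (ext_d \<omega>) 0" by (simp add: d_splits_def zero_Omega)
  then show "mubar (int n) 0 \<omega> = 0 \<and> delbar (int n) 0 \<omega> = 0" using mubar_eq delbar_eq by blast
next
  assume 0: "mubar (int n) 0 \<omega> = 0 \<and> delbar (int n) 0 \<omega> = 0"
  have "ext_d \<omega> \<in> forms (Suc n)" using assms Omega_p0_iff by (intro ext_d_form) blast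
  from split_filtration01_3[OF this ext_d_in_filtration01_3[OF assms]] obtain a b c
    where abc: "a \<in> Omega (int n - 1) 2" "b \<in> Omega (int n) 1" "c \<in> Omega (int n + 1) 0" "ext_d \<omega> = a + b + c"
    by blast
  then have "d_splits (int n) 0 \<omega> a b c 0" by (simp add: d_splits_def zero_Omega)
  from mubar_eq[OF this] delbar_eq[OF this] 0 abc show "ext_d \<omega> \<in> Omega (int n + 1) 0" by simp
qed

lemma delbar_trans_eq_0_iff:
  "\<omega> \<in> Omega_trans (int n) 0 \<and> delbar_trans (int n) 0 \<omega> = 0
    \<longleftrightarrow> \<omega> \<in> Omega (int n) 0 \<and> ext_d \<omega> \<in> Omega (int n + 1) 0"
proof
  assume *: "\<omega> \<in> Omega_trans (int n) 0 \<and> delbar_trans (int n) 0 \<omega> = 0"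
  then obtain b c where bc: "b \<in> Omega_trans (int n) 1" "c \<in> Omega_trans (int n + 1) 0" "ext_d \<omega> = b + c"
    using ext_d_splits_transversally by blast
  with delbar_trans_eq[of b "int n" 0 c \<omega>] * have "ext_d \<omega> = c" by simp
  then show "\<omega> \<in> Omega (int n) 0 \<and> ext_d \<omega> \<in> Omega (int n + 1) 0"
    using * bc by (simp add: Omega_trans_def)
next
  assume *: "\<omega> \<in> Omega (int n) 0 \<and> ext_d \<omega> \<in> Omega (int n + 1) 0"
  have "\<omega> \<in> forms n" using * Omega_p0_iff by blast
  then have "ext_d (ext_d \<omega>) \<in> Omega (int (Suc n) + 1) 0" by (simp only: ext_d_ext_d zero_Omega)
  then have "ext_d \<omega> \<in> Omega_trans (int (Suc n)) 0"
    using * by (intro Omega_trans_if_ext_d_holomorphic) (auto simp: add.commute)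
  then have "ext_d \<omega> \<in> Omega_trans (int n + 1) 0" by (simp add: add.commute)
  then have "delbar_trans (int n) 0 \<omega> = 0"
    by (intro delbar_trans_eq[OF zero_Omega_trans, of "ext_d \<omega>"]) auto
  then show "\<omega> \<in> Omega_trans (int n) 0 \<and> delbar_trans (int n) 0 \<omega> = 0"
    using * Omega_trans_if_ext_d_holomorphic by blast
qed

lemma coset_zero: "x +o {0} = {x :: 'b :: comm_monoid_add}"
  by (simp add: elt_set_plus_def)

lemma im_mubar_trivial: "q < 2 \<Longrightarrow> im_mubar p q = {0}"
  by (simp add: im_mubar_def Omega_negative mubar_zero del: zero_fun_apply)

text \<open>The spaces that are divided out are images of spaces of forms of type \<open>(r,s)\<close> with \<open>s < 0\<close>, which are
zero; so all cosets involved are singletons.\<close>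

lemma H_Dol_0: "H_Dol p 0 = (\<lambda>\<omega>. {{\<omega>}}) ` {\<omega>\<in>Omega p 0. mubar p 0 \<omega> = 0 \<and> delbar p 0 \<omega> = 0}"
proof -
  have H: "H_mubar p q = (\<lambda>\<omega>. {\<omega>}) ` {\<omega>\<in>Omega p q. mubar p q \<omega> = 0}" if "q < 2" for q
    unfolding H_mubar_def im_mubar_trivial[OF that] coset_zero ..
  have D: "delbar_tilde p q {\<omega>} = {delbar p q \<omega>}" if "q < 1" for q \<omega>
    unfolding delbar_tilde_def using that by (simp add: im_mubar_trivial coset_zero del: zero_fun_apply)
  have "H_mubar p (- 1) = {{0}}"
  proof -
    have "{\<omega>\<in>Omega p (- 1). mubar p (- 1) \<omega> = 0} = {0}"
      using Omega_negative[of p "-1"] mubar_zero by auto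
    then show ?thesis unfolding H[of "-1", simplified] by (simp only: image_insert image_empty)
  qed
  then have B: "delbar_tilde p (0 - 1) ` H_mubar p (0 - 1) = {{0}}"
    using D[of "-1" 0] by (simp add: delbar_zero del: zero_fun_apply)
  have C: "C +o {{0}} = {C}" for C :: "'a form set"
    by (simp add: elt_set_plus_def set_plus_def)
  have I: "im_mubar p (0 + 1) = {0}" by (rule im_mubar_trivial) simp
  have "{C\<in>H_mubar p 0. delbar_tilde p 0 C = {0}}
      = (\<lambda>\<omega>. {\<omega>}) ` {\<omega>\<in>Omega p 0. mubar p 0 \<omega> = 0 \<and> delbar p 0 \<omega> = 0}"
    unfolding H[of 0, simplified] by (auto simp: D)
  then show ?thesis
    unfolding H_Dol_def B C I by (simp only: image_image)
qed

lemma H_trans_0: "H_trans p 0 = (\<lambda>\<omega>. {\<omega>}) ` {\<omega>\<in>Omega_trans p 0. delbar_trans p 0 \<omega> = 0}"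
proof -
  have "Omega_trans p (0 - 1) = {0}"
    using zero_Omega_trans[of p "-1"] Omega_negative[of p "-1"] by (auto simp: Omega_trans_def)
  then have "delbar_trans p (0 - 1) ` Omega_trans p (0 - 1) = {0}"
    by (simp only: image_insert image_empty delbar_trans_zero)
  then show ?thesis unfolding H_trans_def by (simp only: coset_zero)
qed

end

theorem proposition3p7:
  fixes atlas :: "('a::{t2_space,second_countable_topology} set \<times> ('a \<Rightarrow> 'e::real_normed_vector)) set"
    and J :: "'a \<Rightarrow> 'a tangent \<Rightarrow> 'a tangent"
    and p :: int
  assumes "almost_complex_manifold atlas J"
    and "p \<ge> 0"
  shows "almost_complex_manifold.H_Dol atlas J p 0
           = (\<lambda>\<omega>. {{\<omega>}}) ` almost_complex_manifold.H_Dol_forms atlas J p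
       \<and> almost_complex_manifold.H_trans atlas J p 0
           = (\<lambda>\<omega>. {\<omega>}) ` almost_complex_manifold.H_trans_forms atlas J p
       \<and> almost_complex_manifold.H_Dol_forms atlas J p
           = almost_complex_manifold.H_trans_forms atlas J p"
proof -
  interpret almost_complex_manifold atlas J by (rule assms(1))
  obtain n where p: "p = int n" using assms(2) nonneg_int_cases by blast
  let ?K = "{\<omega>\<in>Omega p 0. ext_d \<omega> \<in> Omega (p + 1) 0}"
  have D: "H_Dol p 0 = (\<lambda>\<omega>. {{\<omega>}}) ` ?K"
    unfolding H_Dol_0 p using mubar_delbar_eq_0_iff by (intro image_cong) auto
  have T: "H_trans p 0 = (\<lambda>\<omega>. {\<omega>}) ` ?K"
    unfolding H_trans_0 p using delbar_trans_eq_0_iff by (intro image_cong) auto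
  have "H_Dol_forms p = ?K" unfolding H_Dol_forms_def D by auto
  moreover have "H_trans_forms p = ?K" unfolding H_trans_forms_def T by auto
  ultimately show ?thesis using D T by simp
qed

end
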